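(* Let $L_n$ be the number of lucky moves in a uniformly random memory game with $n$ pairs of cards. As $n\to\infty$, $L_n$ converges in distribution to a Poisson random variable with parameter $\ln 2$, that is, $$L_n\stackrel{d}{\longrightarrow}\mathrm{Pois}(\ln 2).$$
   Context: Memory game: there are $2n$ cards with $n$ different labels, two cards for each label; they are arranged in a row, face down, according to a uniformly random permutation of the multiset $\{1,1,2,2,\dots,n,n\}$. In each round (move) the player flips over two cards; if they match (have the same label) they are removed, otherwise they are turned face down again. The game ends when all cards are removed. The player has perfect memory and uses the following strategy, exploring cards from left to right. Before starting round $t$, if she knows the places of two identical cards not yet removed (i.e. one of them was flipped over in round $t-1$ and its match was flipped over before round $t-1$), then in round $t$ she flips these two cards and removes the pair. Otherwise she flips over the leftmost card that has never been flipped over. If its matching card has been flipped over previously, she flips that matching card once again, and removes the pair; if not, the second card she flips in this round is the next (leftmost) never-flipped card (and if the two cards match, they are removed). A lucky move is a round in which two matching cards are flipped over and neither of these two cards had been flipped over before this round (such cards are necessarily adjacent in the initial arrangement). $L_n$ is the total number of lucky moves in the game. *)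

theory Defs
  imports "HOL-Probability.Probability" "HOL-Combinatorics.Multiset_Permutations"
begin

text \<open>
  A deck is the list of labels of the cards in the row, from left to right; cards are
  identified with their positions, counted from 0.
\<close>

definition random_deck :: "nat \<Rightarrow> nat list pmf" where
  "random_deck n =
     pmf_of_set (permutations_of_multiset (mset_set {1..n} + mset_set {1..n}))"

text \<open>
  The state between two rounds: the cards that have been flipped over at least once so far
  (including those already removed), and the cards that have been removed.
\<close>

record game_state =
  flipped :: "nat set"
  removed :: "nat set"

definition game_over :: "nat list \<Rightarrow> game_state \<Rightarrow> bool" where
  "game_over d s \<longleftrightarrow> removed s = {..<length d}"

definition known_pair :: "nat list \<Rightarrow> game_state \<Rightarrow> nat \<times> nat \<Rightarrow> bool" where
  "known_pair d s = (\<lambda>(i, j). i < j \<and> d ! i = d ! j \<and>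
     {i, j} \<subseteq> flipped s \<and> {i, j} \<inter> removed s = {})"

text \<open>
  The two cards flipped over in the next round. In every reachable state there is at most one
  known pair, so the choice by \<open>SOME\<close> is forced. As long as the game is not over, the cards
  selected by \<open>LEAST\<close> and \<open>THE\<close> exist; in particular, if the match of the first new card has
  not been seen, there is a second new card.
\<close>

definition next_move :: "nat list \<Rightarrow> game_state \<Rightarrow> nat \<times> nat" where
  "next_move d s =
     (if \<exists>p. known_pair d s p then SOME p. known_pair d s p
      else let a = LEAST i. i \<notin> flipped s in
        if \<exists>b \<in> flipped s. d ! b = d ! a
        then (a, THE b. b \<in> flipped s \<and> d ! b = d ! a)
        else (a, LEAST i. i \<notin> insert a (flipped s)))"

definition play_round :: "nat list \<Rightarrow> game_state \<Rightarrow> game_state" where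
  "play_round d s =
     (if game_over d s then s
      else case next_move d s of (a, b) \<Rightarrow>
        \<lparr>flipped = flipped s \<union> {a, b},
         removed = (if d ! a = d ! b then removed s \<union> {a, b} else removed s)\<rparr>)"

text \<open>The state after \<open>t\<close> rounds, i.e. just before the round with index \<open>t\<close> (counted from 0).\<close>

definition state_after :: "nat list \<Rightarrow> nat \<Rightarrow> game_state" where
  "state_after d t = (play_round d ^^ t) \<lparr>flipped = {}, removed = {}\<rparr>"

definition lucky_move :: "nat list \<Rightarrow> nat \<Rightarrow> bool" where
  "lucky_move d t \<longleftrightarrow>
     (let s = state_after d t in \<not> game_over d s \<and>
        (case next_move d s of (a, b) \<Rightarrow>
           d ! a = d ! b \<and> a \<notin> flipped s \<and> b \<notin> flipped s))"

text \<open>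
  The set below is finite for every deck in the support of \<^const>\<open>random_deck\<close>, because
  every round before the end of the game flips a new card or removes a pair.
\<close>

definition lucky_moves :: "nat list \<Rightarrow> nat" where
  "lucky_moves d = card {t. lucky_move d t}"

end

theory Submission
  imports Defs "HOL-Real_Asymp.Real_Asymp"
begin

text \<open>
  As long as no known pair lies on the table, the player turns over the leftmost new card, at
  position \<open>k\<close> say, and continues at \<open>k + 1\<close> if its label was seen before and at \<open>k + 2\<close> otherwise.
  So the positions at which exploring rounds begin, the \<^emph>\<open>round starts\<close>, depend only on the word
  \<open>u\<close> that records which cards show a label for the first time: position 0 is a start, and
  \<open>k + 1\<close> is one iff not both \<open>k\<close> is a start and \<open>u\<close> holds at \<open>k\<close>. The lucky moves correspond to the
  starts \<open>k\<close> at which cards \<open>k\<close> and \<open>k + 1\<close> agree (\<open>lucky_moves_deck\<close>).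

  Write \<open>L\<close> for the number of lucky pairs and \<open>S\<close> for the number of starts. Removing a lucky pair from
  a deck leaves a deck in which its position is still a start, and a pair with a fresh label can be
  inserted at any start and is lucky there. Since the process merely jumps over that pair, the
  insertion raises both \<open>L\<close> and \<open>S\<close> by exactly one. Counting decks with a marked lucky pair in the
  two ways gives, for every function \<open>h\<close>,
  \<open>E\<^sub>n [L * h(L, S)] = E\<^sub>m [S * h(L + 1, S + 1)] / (2 * n - 1)\<close> with \<open>m = n - 1\<close>
  (\<open>lucky_insertion_identity\<close>). Iterating it, the \<open>r\<close>-th factorial moment of \<open>L\<close> is the mean of
  \<open>S * (S + 1) * ... * (S + r - 1)\<close> in decks of \<open>n - r\<close> pairs, divided by
  \<open>(2 * n - 1) * (2 * n - 3) * ... * (2 * n - 2 * r + 1)\<close> (\<open>sum_decks_joint_moment\<close>). Hence everything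
  follows from the law of large numbers \<open>S / (2 * n) \<longlonglongrightarrow> ln 2\<close> (\<open>start_density\<close>): the factorial moments
  of \<open>L\<close> then tend to \<open>(ln 2) ^ r\<close>, those of the Poisson distribution.

  Unrolling the recursion for starts expresses \<open>S\<close> as the alternating sum of the numbers \<open>R\<^sub>j\<close> of
  windows of \<open>j\<close> consecutive first occurrences, and truncating it after \<open>J\<close> terms costs at most \<open>R\<^sub>J\<close>
  (\<open>card_starts_bonferroni\<close>). At a fraction \<open>x\<close> of the deck a card is new with probability about
  \<open>1 - x\<close>, so one expects \<open>R\<^sub>j\<close> to be about \<open>2 * n\<close> times the integral of \<open>(1 - x) ^ j\<close>, that is
  \<open>2 * n / (j + 1)\<close>, and the alternating harmonic series has the sum \<open>ln 2\<close>.
  The concentration of \<open>R\<^sub>j\<close> comes from a way to grow the random word: add a last card and insert its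
  match in a uniformly random gap. Averaged over the gaps, the change of \<open>R\<^sub>j\<close> is an explicit linear
  combination of \<open>R\<^sub>j\<close> and \<open>R\<close> with index \<open>j - 1\<close> (\<open>sum_runs_insert_at\<close>), while a single insertion changes
  \<open>R\<^sub>j\<close> by a bounded amount. By induction on \<open>j\<close> the mean square deviation of \<open>R\<^sub>j\<close> from \<open>2 * n / (j + 1)\<close>
  is \<open>O(n)\<close> (\<open>run_dev_second_moment\<close>).

  The mean of \<open>z ^ L\<close> is the sum over \<open>r\<close> of the mean of \<open>L choose r\<close> times \<open>(z - 1) ^ r\<close>. The former is at
  most \<open>1 / r!\<close> for all \<open>n\<close> (\<open>joint_moment_bounds\<close>), so Tannery's theorem allows passing to the limit
  term by term. At \<open>z = exp (i * t)\<close> this is convergence of the characteristic functions, and Levy's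
  continuity theorem concludes.
\<close>

section \<open>Decks, first occurrences and round starts\<close>

text \<open>
  The decks with an arbitrary finite set of labels: removing both cards of a label then leads to decks
  over the remaining labels, without any renaming.
\<close>

definition decks :: "'a set \<Rightarrow> 'a list set" where
  "decks A = permutations_of_multiset (mset_set A + mset_set A)"

lemma decks_iff: "d \<in> decks A \<longleftrightarrow> mset d = mset_set A + mset_set A"
  by (simp add: decks_def permutations_of_multiset_def)

lemma finite_decks [simp]: "finite (decks A)"
  by (simp add: decks_def)

lemma decks_empty [simp]: "decks {} = {[]}"
  by (simp add: decks_def)

lemma length_deck: "d \<in> decks A \<Longrightarrow> length d = 2 * card A"
  by (metis decks_iff mult_2 size_mset size_mset_set size_union)

lemma set_deck: "finite A \<Longrightarrow> d \<in> decks A \<Longrightarrow> set d = A"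
  by (metis decks_iff finite_set_mset_mset_set set_mset_mset set_mset_union sup.idem)

lemma count_deck: "finite A \<Longrightarrow> d \<in> decks A \<Longrightarrow> count (mset d) x = (if x \<in> A then 2 else 0)"
  by (simp add: decks_iff)

lemma decks_remove_label:
  assumes "finite A" "a \<in> A" "mset d = mset d' + {#a, a#}"
  shows "d \<in> decks A \<longleftrightarrow> d' \<in> decks (A - {a})"
proof -
  have "mset_set A = add_mset a (mset_set (A - {a}))"
    using assms(1,2) by (metis mset_set.remove)
  then show ?thesis using assms(3) by (simp add: decks_iff)
qed

text \<open>
  Entry \<open>k\<close> tells whether card \<open>k\<close> shows a label that occurs neither earlier in the list nor in \<open>X\<close>;
  the set \<open>X\<close> of labels seen before makes the function compatible with appending.
\<close>

primrec novelty :: "'a set \<Rightarrow> 'a list \<Rightarrow> bool list" where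
  "novelty X [] = []"
| "novelty X (x # d) = (x \<notin> X) # novelty (insert x X) d"

lemma length_novelty [simp]: "length (novelty X d) = length d"
  by (induction d arbitrary: X) auto

lemma novelty_append: "novelty X (d @ e) = novelty X d @ novelty (X \<union> set d) e"
  by (induction d arbitrary: X) auto

lemma novelty_insert_irrelevant: "a \<notin> set d \<Longrightarrow> novelty (insert a X) d = novelty X d"
proof (induction d arbitrary: X)
  case (Cons x d)
  then show ?case using Cons.IH[of "insert x X"] by (auto simp: insert_commute[of x a])
qed simp

lemma nth_novelty: "k < length d \<Longrightarrow> novelty X d ! k \<longleftrightarrow> d ! k \<notin> X \<union> set (take k d)"
  by (induction d arbitrary: X k) (auto simp: nth_Cons split: nat.splits)

lemma novelty_take_drop: "novelty X d = novelty X (take k d) @ novelty (X \<union> set (take k d)) (drop k d)"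
  by (metis append_take_drop_id novelty_append)

lemma take_drop_novelty:
  "take k (novelty X d) = novelty X (take k d)"
  "drop k (novelty X d) = novelty (X \<union> set (take k d)) (drop k d)"
  by (subst novelty_take_drop[of X d k], cases "k \<le> length d"; simp)+

abbreviation "deck_word \<equiv> novelty {}"

text \<open>
  A round that begins at \<open>k\<close> consumes the new cards \<open>k\<close> and \<open>k + 1\<close> if the label at \<open>k\<close> is new, and only
  card \<open>k\<close> otherwise. So \<open>k + 1\<close> is jumped over iff \<open>k\<close> is a start with a new label.
\<close>

primrec round_start :: "bool list \<Rightarrow> nat \<Rightarrow> bool" where
  "round_start w 0 = True"
| "round_start w (Suc k) = (\<not> (round_start w k \<and> w ! k))"

text \<open>
  The position just behind the last card is included because a pair can be inserted there too.
\<close>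

definition starts :: "bool list \<Rightarrow> nat set" where
  "starts w = {k. k \<le> length w \<and> round_start w k}"

lemma finite_starts [simp]: "finite (starts w)"
  by (simp add: starts_def)

lemma card_starts_le: "card (starts w) \<le> Suc (length w)"
  using card_mono[of "{..length w}" "starts w"] by (auto simp: starts_def)

definition lucky_positions :: "'a list \<Rightarrow> nat set" where
  "lucky_positions d = {k. Suc k < length d \<and> round_start (deck_word d) k \<and> d ! k = d ! Suc k}"

lemma finite_lucky_positions [simp]: "finite (lucky_positions d)"
  by (rule finite_subset[of _ "{..length d}"]) (auto simp: lucky_positions_def)

section \<open>Rounds of the game\<close>

text \<open>
  The lucky rounds are counted along the rest of the game from an arbitrary state, so that the count
  obeys a recursion in that state.
\<close>

definition lucky_in_state :: "nat list \<Rightarrow> game_state \<Rightarrow> bool" where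
  "lucky_in_state d s \<longleftrightarrow> \<not> game_over d s \<and>
     (case next_move d s of (a, b) \<Rightarrow> d ! a = d ! b \<and> a \<notin> flipped s \<and> b \<notin> flipped s)"

definition lucky_times :: "nat list \<Rightarrow> game_state \<Rightarrow> nat set" where
  "lucky_times d s = {t. lucky_in_state d ((play_round d ^^ t) s)}"

lemma lucky_times_step:
  "lucky_times d s = (if lucky_in_state d s then {0} else {}) \<union> Suc ` lucky_times d (play_round d s)"
    (is "?L = ?R")
proof (rule set_eqI)
  fix t show "t \<in> ?L \<longleftrightarrow> t \<in> ?R"
    by (cases t) (auto simp: lucky_times_def funpow_swap1)
qed

lemma card_lucky_times_step:
  assumes "finite (lucky_times d (play_round d s))"
  shows "finite (lucky_times d s)"
    and "card (lucky_times d s) = of_bool (lucky_in_state d s) + card (lucky_times d (play_round d s))"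
  using assms by (auto simp: lucky_times_step[of d s] card_image card_insert_if)

lemma lucky_times_game_over:
  assumes "game_over d s"
  shows "lucky_times d s = {}"
proof -
  have "(play_round d ^^ t) s = s" for t
    by (induction t) (auto simp: play_round_def assms)
  then show ?thesis by (simp add: lucky_times_def lucky_in_state_def assms)
qed

definition seen_pairs :: "nat list \<Rightarrow> nat \<Rightarrow> nat set" where
  "seen_pairs d k = {i. i < k \<and> (\<exists>j<k. j \<noteq> i \<and> d ! j = d ! i)}"

lemma seen_pairs_mono: "k \<le> l \<Longrightarrow> seen_pairs d k \<subseteq> seen_pairs d l"
  unfolding seen_pairs_def by (blast intro: less_le_trans)

text \<open>
  The states before exploring rounds: the first \<open>k\<close> cards have been seen and every pair among them is
  gone.
\<close>

definition cleared_state :: "nat list \<Rightarrow> nat \<Rightarrow> game_state" where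
  "cleared_state d k = \<lparr>flipped = {..<k}, removed = seen_pairs d k\<rparr>"

locale paired_deck =
  fixes d :: "nat list"
  assumes pairs: "i < length d \<Longrightarrow> card {j. j < length d \<and> d ! j = d ! i} = 2"
begin

lemma partner:
  assumes "i < length d"
  obtains j where "j < length d" "j \<noteq> i" "d ! j = d ! i"
    "\<And>m. m < length d \<Longrightarrow> d ! m = d ! i \<Longrightarrow> m = i \<or> m = j"
proof -
  obtain x y where xy: "{j. j < length d \<and> d ! j = d ! i} = {x, y}" "x \<noteq> y"
    using pairs[OF assms] by (auto simp: card_2_iff)
  moreover have "i \<in> {j. j < length d \<and> d ! j = d ! i}" using assms by simp
  ultimately have "i = x \<or> i = y" by auto
  then obtain j where j: "{m. m < length d \<and> d ! m = d ! i} = {i, j}" "j \<noteq> i"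
    using xy by (metis insert_commute)
  then have "j < length d \<and> d ! j = d ! i" by auto
  with j that show ?thesis by auto
qed

lemma no_triple:
  assumes "i < length d" "j < length d" "k < length d" "d ! i = d ! j" "d ! j = d ! k"
  shows "i = j \<or> j = k \<or> i = k"
  using partner[OF assms(2)] assms by metis

lemma novel_iff: "k < length d \<Longrightarrow> deck_word d ! k \<longleftrightarrow> (\<forall>b<k. d ! b \<noteq> d ! k)"
  by (auto simp: nth_novelty in_set_conv_nth)

lemma not_known_pair_cleared: "\<not> known_pair d (cleared_state d k) p"
  by (cases p) (auto simp: known_pair_def cleared_state_def seen_pairs_def)

lemma not_game_over_cleared: "k < length d \<Longrightarrow> \<not> game_over d (cleared_state d k)"
  by (auto simp: game_over_def cleared_state_def seen_pairs_def)

lemma game_over_cleared: "game_over d (cleared_state d (length d))"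
proof -
  have "i \<in> seen_pairs d (length d)" if "i < length d" for i
    using partner[OF that] that by (auto simp: seen_pairs_def)
  then show ?thesis by (auto simp: game_over_def cleared_state_def seen_pairs_def)
qed

lemma Least_new_card: "(LEAST i. \<not> i < k) = (k :: nat)" "(LEAST i. i \<noteq> k \<and> \<not> i < k) = Suc k"
  by (intro Least_equality; auto)+

lemma next_move_seen:
  assumes "k < length d" "b < k" "d ! b = d ! k"
  shows "next_move d (cleared_state d k) = (k, b)"
proof -
  have "(THE b. b < k \<and> d ! b = d ! k) = b"
    using assms no_triple[of _ b k] by (intro the_equality) (auto, metis less_trans nat_neq_iff)
  moreover have "\<exists>b\<in>{..<k}. d ! b = d ! k" using assms by auto
  ultimately show ?thesis
    using assms not_known_pair_cleared[of k]
    by (simp add: next_move_def Let_def Least_new_card cleared_state_def)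
qed

lemma next_move_novel:
  assumes "k < length d" "deck_word d ! k"
  shows "next_move d (cleared_state d k) = (k, Suc k)"
proof -
  have "\<not> (\<exists>b\<in>{..<k}. d ! b = d ! k)" using assms novel_iff by auto
  then show ?thesis
    using not_known_pair_cleared[of k]
    by (simp add: next_move_def Let_def Least_new_card cleared_state_def)
qed

lemma play_round_seen:
  assumes "k < length d" "b < k" "d ! b = d ! k"
  shows "play_round d (cleared_state d k) = cleared_state d (Suc k)"
proof -
  have "seen_pairs d (Suc k) = seen_pairs d k \<union> {k, b}"
    using assms no_triple[of _ b k] by (auto simp: seen_pairs_def less_Suc_eq)
  then show ?thesis
    using next_move_seen[OF assms] not_game_over_cleared[OF assms(1)] assms
    by (auto simp: play_round_def cleared_state_def)
qed

lemma novel_not_last: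
  assumes "k < length d" "deck_word d ! k"
  shows "Suc k < length d"
proof -
  obtain j where "j < length d" "j \<noteq> k" "d ! j = d ! k" using partner[OF assms(1)] by metis
  moreover have "\<not> j < k" using assms novel_iff calculation by auto
  ultimately show ?thesis by simp
qed

lemma play_round_lucky:
  assumes "k < length d" "deck_word d ! k" "d ! k = d ! Suc k"
  shows "play_round d (cleared_state d k) = cleared_state d (k + 2)"
proof -
  have "seen_pairs d (k + 2) = seen_pairs d k \<union> {k, Suc k}" (is "?L = ?R")
  proof (intro equalityI subsetI)
    have novel: "d ! b \<noteq> d ! k" "d ! b \<noteq> d ! Suc k" if "b < k" for b
      using assms novel_iff[of k] that by simp_all
    fix i assume "i \<in> ?L"
    then obtain j where ij: "i < k + 2" "j < k + 2" "j \<noteq> i" "d ! j = d ! i" by (auto simp: seen_pairs_def)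
    then have "i = k \<or> i = Suc k \<or> (i < k \<and> j < k)"
      using novel[of i] by (auto simp: less_Suc_eq)
    then show "i \<in> ?R" using ij by (auto simp: seen_pairs_def)
  next
    fix i assume "i \<in> ?R"
    moreover have "seen_pairs d k \<subseteq> ?L" by (rule seen_pairs_mono) simp
    moreover have "k \<in> ?L"
      unfolding seen_pairs_def using assms(3) by (intro CollectI conjI exI[of _ "Suc k"]) simp_all
    moreover have "Suc k \<in> ?L"
      unfolding seen_pairs_def using assms(3) by (intro CollectI conjI exI[of _ k]) simp_all
    ultimately show "i \<in> ?L" by auto
  qed
  then show ?thesis
    using next_move_novel[OF assms(1,2)] not_game_over_cleared[OF assms(1)] assms
    by (auto simp: play_round_def cleared_state_def)
qed

lemma play_round_unmatched:
  assumes "k < length d" "deck_word d ! k" "d ! k \<noteq> d ! Suc k"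
  shows "play_round d (cleared_state d k) = \<lparr>flipped = {..<k + 2}, removed = seen_pairs d k\<rparr>"
  using next_move_novel[OF assms(1,2)] not_game_over_cleared[OF assms(1)] assms
  by (auto simp: play_round_def cleared_state_def)

lemma seen_pairs_two_novel:
  assumes "k < length d" "deck_word d ! k" "d ! k \<noteq> d ! Suc k" "deck_word d ! Suc k"
  shows "seen_pairs d (k + 2) = seen_pairs d k"
proof -
  have "\<forall>b<k. d ! b \<noteq> d ! k" "\<forall>b<k. d ! b \<noteq> d ! Suc k"
    using assms novel_iff[of k] novel_iff[of "Suc k"] novel_not_last[of k] by auto
  then show ?thesis using assms(3) by (auto simp: seen_pairs_def less_Suc_eq)
qed

text \<open>
  If card \<open>k\<close> is new and card \<open>k + 1\<close> matches an earlier card, the next round is spent on removing that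
  pair, which is not lucky, and it restores a cleared state.
\<close>

lemma remove_known_pair:
  assumes "k < length d" "deck_word d ! k" "d ! k \<noteq> d ! Suc k" "\<not> deck_word d ! Suc k"
  defines "s \<equiv> \<lparr>flipped = {..<k + 2}, removed = seen_pairs d k\<rparr>"
  shows "play_round d s = cleared_state d (k + 2)" "\<not> lucky_in_state d s"
proof -
  have k: "Suc k < length d" by (rule novel_not_last) fact+
  then obtain b where b: "b < Suc k" "d ! b = d ! Suc k" using novel_iff[of "Suc k"] assms(4) by auto
  then have "b < k" using assms(3) less_antisym by blast
  have novel: "d ! i \<noteq> d ! k" if "i < k" for i using novel_iff[OF assms(1)] assms(2) that by auto
  have known: "known_pair d s p \<longleftrightarrow> p = (b, Suc k)" for p
  proof
    assume p: "known_pair d s p"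
    obtain i j where [simp]: "p = (i, j)" by (cases p)
    have ij: "i < j" "j < k + 2" "d ! i = d ! j" "i \<notin> seen_pairs d k"
      using p by (auto simp: known_pair_def s_def)
    then have "j \<ge> k" by (auto simp: seen_pairs_def) (metis less_trans nat_neq_iff not_le)
    moreover have "j \<noteq> k" using ij novel by auto
    ultimately have j: "j = Suc k" using ij by simp
    then have "i = b" using no_triple[of i b "Suc k"] ij b k \<open>b < k\<close> by auto
    with j show "p = (b, Suc k)" by simp
  next
    assume "p = (b, Suc k)"
    moreover have "b \<notin> seen_pairs d k"
    proof
      assume "b \<in> seen_pairs d k"
      then obtain j where "j < k" "j \<noteq> b" "d ! j = d ! b" by (auto simp: seen_pairs_def)
      then show False using no_triple[of j b "Suc k"] b k by auto
    qed
    moreover have "Suc k \<notin> seen_pairs d k" by (simp add: seen_pairs_def)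
    ultimately show "known_pair d s p" using b \<open>b < k\<close> by (auto simp: known_pair_def s_def)
  qed
  have move: "next_move d s = (b, Suc k)" 
  proof -
    have "known_pair d s = (\<lambda>p. p = (b, Suc k))" by (rule ext) (rule known)
    then show ?thesis by (simp add: next_move_def)
  qed
  have not_over: "\<not> game_over d s"
    using assms(1) by (auto simp: game_over_def s_def seen_pairs_def)
  have "seen_pairs d (k + 2) = seen_pairs d k \<union> {b, Suc k}" (is "?L = ?R")
  proof (intro equalityI subsetI)
    fix i assume "i \<in> ?L"
    then obtain j where ij: "i < k + 2" "j < k + 2" "j \<noteq> i" "d ! j = d ! i" by (auto simp: seen_pairs_def)
    have "i = Suc k \<or> (i < k \<and> j < k) \<or> (i < k \<and> j = Suc k)"
      using ij novel[of i] novel[of j] assms(3) by (auto simp: less_Suc_eq)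
    moreover have "i = b" if "i < k" "j = Suc k"
    proof -
      have "d ! i = d ! Suc k" "i < length d" "b < length d" using that ij(4) k \<open>b < k\<close> by simp_all
      from no_triple[OF this(2) k this(3) this(1) b(2)[symmetric]] show ?thesis
        using that(1) \<open>b < k\<close> by simp
    qed
    ultimately show "i \<in> ?R" using ij by (auto simp: seen_pairs_def)
  next
    fix i assume "i \<in> ?R"
    moreover have "seen_pairs d k \<subseteq> ?L" by (rule seen_pairs_mono) simp
    moreover have "b \<in> ?L"
      using b \<open>b < k\<close> unfolding seen_pairs_def by (intro CollectI conjI exI[of _ "Suc k"]) auto
    moreover have "Suc k \<in> ?L"
      using b \<open>b < k\<close> unfolding seen_pairs_def by (intro CollectI conjI exI[of _ b]) auto
    ultimately show "i \<in> ?L" by auto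
  qed
  then show "play_round d s = cleared_state d (k + 2)"
    using move not_over b \<open>b < k\<close> by (auto simp: play_round_def s_def cleared_state_def)
  show "\<not> lucky_in_state d s" using move not_over by (simp add: lucky_in_state_def s_def)
qed

text \<open>
  Backward induction on \<open>k\<close>: from a cleared state one or two rounds lead to the cleared state at
  the next start, and only the exploring one can be lucky.
\<close>

lemma lucky_times_cleared:
  assumes "k \<le> length d" "round_start (deck_word d) k"
  shows "finite (lucky_times d (cleared_state d k)) \<and>
    card (lucky_times d (cleared_state d k)) = card {i \<in> lucky_positions d. k \<le> i}"
  using assms
proof (induction "length d - k" arbitrary: k rule: less_induct)
  case less
  let ?s = "cleared_state d k"
  let ?G = "\<lambda>s m. finite (lucky_times d s) \<and> card (lucky_times d s) = m"
  have step: "?G s (of_bool (lucky_in_state d s) + m)" if "?G (play_round d s) m" for s m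
    using card_lucky_times_step[of d s] that by auto
  consider "k = length d" | b where "k < length d" "b < k" "d ! b = d ! k" | "k < length d" "deck_word d ! k"
    using less.prems novel_iff[of k] by (metis le_neq_implies_less)
  then show ?case
  proof cases
    case 1
    then have "{i \<in> lucky_positions d. k \<le> i} = {}" by (auto simp: lucky_positions_def)
    then show ?thesis using 1 lucky_times_game_over[OF game_over_cleared] by simp
  next
    case 2
    have "\<not> deck_word d ! k" using 2 novel_iff by auto
    then have IH: "?G (cleared_state d (Suc k)) (card {i \<in> lucky_positions d. Suc k \<le> i})"
      using 2 less.prems by (intro less.hyps) auto
    have "k \<notin> lucky_positions d"
      using no_triple[of b k "Suc k"] 2 by (auto simp: lucky_positions_def)
    then have "{i \<in> lucky_positions d. k \<le> i} = {i \<in> lucky_positions d. Suc k \<le> i}"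
      by (auto simp: Suc_le_eq order_le_less)
    moreover have "\<not> lucky_in_state d ?s"
      using next_move_seen[OF 2] 2 by (simp add: lucky_in_state_def cleared_state_def)
    ultimately show ?thesis using step[of ?s] IH play_round_seen[OF 2] by simp
  next
    case 3
    have k2: "Suc k < length d" using novel_not_last 3 by blast
    have "\<not> round_start (deck_word d) (Suc k)" using less.prems 3 by simp
    then have IH: "?G (cleared_state d (k + 2)) (card {i \<in> lucky_positions d. k + 2 \<le> i})"
      using k2 by (intro less.hyps) auto
    have "Suc k \<notin> lucky_positions d" using \<open>\<not> round_start (deck_word d) (Suc k)\<close> 
      by (auto simp: lucky_positions_def)
    then have tail: "i \<in> lucky_positions d \<and> k \<le> i \<longleftrightarrow>
        (i = k \<and> k \<in> lucky_positions d) \<or> (i \<in> lucky_positions d \<and> k + 2 \<le> i)" for i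
    proof -
      have "i = k \<or> i = Suc k \<or> k + 2 \<le> i \<or> i < k" by arith
      then show ?thesis using \<open>Suc k \<notin> lucky_positions d\<close> by auto
    qed
    have lucky: "lucky_in_state d ?s \<longleftrightarrow> d ! k = d ! Suc k"
      using next_move_novel[OF 3] not_game_over_cleared[OF 3(1)]
      by (simp add: lucky_in_state_def cleared_state_def)
    show ?thesis
    proof (cases "d ! k = d ! Suc k")
      case True
      then have "k \<in> lucky_positions d" using less.prems k2 by (simp add: lucky_positions_def)
      then have "{i \<in> lucky_positions d. k \<le> i} = insert k {i \<in> lucky_positions d. k + 2 \<le> i}"
        using tail by auto
      then show ?thesis
        using step[of ?s] IH play_round_lucky[OF 3 True] lucky True by simp
    next
      case False
      let ?u = "\<lparr>flipped = {..<k + 2}, removed = seen_pairs d k\<rparr>"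
      have "k \<notin> lucky_positions d" using False by (simp add: lucky_positions_def)
      then have set_eq: "{i \<in> lucky_positions d. k \<le> i} = {i \<in> lucky_positions d. k + 2 \<le> i}"
        using tail by auto
      have "?G ?u (card {i \<in> lucky_positions d. k + 2 \<le> i})"
      proof (cases "deck_word d ! Suc k")
        case True
        have "?u = cleared_state d (k + 2)"
          using seen_pairs_two_novel[OF 3 False True] by (simp add: cleared_state_def)
        then show ?thesis using IH by simp
      next
        case novel: False
        show ?thesis using step[of ?u] IH remove_known_pair[OF 3 False novel] by simp
      qed
      then show ?thesis
        using step[of ?s] play_round_unmatched[OF 3 False] lucky False set_eq by simp
    qed
  qed
qed

lemma lucky_moves_eq: "lucky_moves d = card (lucky_positions d)"
proof -
  have "{t. lucky_move d t} = lucky_times d (cleared_state d 0)"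
    by (simp add: lucky_move_def lucky_times_def lucky_in_state_def state_after_def Let_def
        cleared_state_def seen_pairs_def)
  then show ?thesis
    using lucky_times_cleared[of 0] by (simp add: lucky_moves_def)
qed

end

lemma lucky_moves_deck:
  assumes "finite A" "d \<in> decks A"
  shows "lucky_moves d = card (lucky_positions d)"
proof -
  have "paired_deck d"
  proof
    fix i assume "i < length d"
    then have "count (mset d) (d ! i) = 2"
      using count_deck[OF assms, of "d ! i"] set_deck[OF assms] by (auto dest: nth_mem)
    moreover have "{j. j < length d \<and> d ! j = d ! i} = {j. j < length d \<and> d ! i = d ! j}" by auto
    ultimately show "card {j. j < length d \<and> d ! j = d ! i} = 2"
      by (simp only: count_mset count_list_eq_length_filter length_filter_conv_card)
  qed
  then show ?thesis by (rule paired_deck.lucky_moves_eq)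
qed

section \<open>Removing and inserting a lucky pair\<close>

definition insert_pair :: "nat \<Rightarrow> 'a \<Rightarrow> 'a list \<Rightarrow> 'a list" where
  "insert_pair k a d = take k d @ a # a # drop k d"

lemma length_insert_pair [simp]: "length (insert_pair k a d) = length d + 2"
  by (simp add: insert_pair_def)

lemma mset_insert_pair: "mset (insert_pair k a d) = mset d + {#a, a#}"
proof -
  have "mset (insert_pair k a d) = mset (take k d @ drop k d) + {#a, a#}"
    unfolding insert_pair_def mset_append by simp
  then show ?thesis by simp
qed

lemma nth_insert_pair:
  assumes "k \<le> length d"
  shows "insert_pair k a d ! i = (if i < k then d ! i else if i < k + 2 then a else d ! (i - 2))"
proof (cases "i < k + 2")
  case True
  then have "i < k \<or> i = k \<or> i = Suc k" by arith
  then show ?thesis using assms by (auto simp: insert_pair_def nth_append)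
next
  case False
  then obtain j where "i = k + 2 + j" using le_Suc_ex not_less by blast
  then show ?thesis using assms by (simp add: insert_pair_def nth_append)
qed

lemma deck_word_insert_pair:
  assumes "a \<notin> set d"
  shows "deck_word (insert_pair k a d) = take k (deck_word d) @ True # False # drop k (deck_word d)"
proof -
  have "a \<notin> set (take k d)" "a \<notin> set (drop k d)" using assms by (auto dest: in_set_takeD in_set_dropD)
  then show ?thesis
    by (simp add: insert_pair_def novelty_append take_drop_novelty novelty_insert_irrelevant)
qed

lemma round_start_take: "take k v = take k w \<Longrightarrow> i \<le> k \<Longrightarrow> round_start v i = round_start w i"
proof (induction i)
  case (Suc i)
  then have "v ! i = w ! i" by (metis Suc_le_lessD nth_take)
  with Suc show ?case by simp
qed simp

text \<open>
  A pair with a fresh label contributes the entries \<open>True, False\<close> to the word. Starting at its first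
  card, the process jumps over the pair and goes on as it would have done without it.
\<close>

lemma round_start_insert_pair:
  assumes "a \<notin> set d" "k \<le> length d"
  shows "i \<le> k \<Longrightarrow> round_start (deck_word (insert_pair k a d)) i = round_start (deck_word d) i"
    and "round_start (deck_word d) k \<Longrightarrow> \<not> round_start (deck_word (insert_pair k a d)) (Suc k)"
    and "round_start (deck_word d) k \<Longrightarrow> k \<le> i \<Longrightarrow>
           round_start (deck_word (insert_pair k a d)) (i + 2) = round_start (deck_word d) i"
proof -
  define w where "w = deck_word d"
  define v where "v = deck_word (insert_pair k a d)"
  have k: "k \<le> length w" using assms by (simp add: w_def)
  have v: "v = take k w @ True # False # drop k w"
    using deck_word_insert_pair[OF assms(1)] by (simp add: w_def v_def)
  have le: "round_start v i = round_start w i" if "i \<le> k" for i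
    using k that by (intro round_start_take[of k]) (auto simp: v)
  show "i \<le> k \<Longrightarrow> round_start (deck_word (insert_pair k a d)) i = round_start (deck_word d) i"
    using le by (simp add: v_def w_def)
  have vk: "v ! k" "v ! Suc k = False" using k by (auto simp: v nth_append)
  have k1: "\<not> round_start v (Suc k)" if "round_start w k" using that le[of k] vk by simp
  then show "round_start (deck_word d) k \<Longrightarrow> \<not> round_start (deck_word (insert_pair k a d)) (Suc k)"
    by (simp add: v_def w_def)
  have "round_start v (i + 2) = round_start w i" if "round_start w k" "k \<le> i"
    using that(2)
  proof (induction i rule: dec_induct)
    case base
    then show ?case using k1 that(1) by simp
  next
    case (step i)
    have "v ! (i + 2) = w ! i" using k step.hyps by (auto simp: v nth_append min_def)
    with step show ?case by simp
  qed
  then show "round_start (deck_word d) k \<Longrightarrow> k \<le> i \<Longrightarrow>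
           round_start (deck_word (insert_pair k a d)) (i + 2) = round_start (deck_word d) i"
    by (simp add: v_def w_def)
qed

lemma nat_cases_pair: fixes i k :: nat obtains "i < k" | "i = k" | "i = Suc k" | j where "i = j + 2" "k \<le> j"
proof -
  have "i < k \<or> i = k \<or> i = Suc k \<or> (i = (i - 2) + 2 \<and> k \<le> i - 2)" by arith
  then show ?thesis using that by metis
qed

lemma card_starts_insert_pair:
  assumes "a \<notin> set d" "k \<in> starts (deck_word d)"
  shows "card (starts (deck_word (insert_pair k a d))) = Suc (card (starts (deck_word d)))"
proof -
  let ?S = "starts (deck_word d)"
  have k: "k \<le> length d" "round_start (deck_word d) k" using assms(2) by (auto simp: starts_def)
  note rs = round_start_insert_pair[OF assms(1) k(1)]
  have "starts (deck_word (insert_pair k a d)) = {i\<in>?S. i < k} \<union> {k} \<union> (\<lambda>i. i + 2) ` {i\<in>?S. k \<le> i}" (is "?L = ?R")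
  proof (rule set_eqI)
    fix i show "i \<in> ?L \<longleftrightarrow> i \<in> ?R"
    proof (cases i k rule: nat_cases_pair)
      case 1
      then show ?thesis using k by (auto simp: starts_def rs(1))
    next
      case 2
      then show ?thesis using k by (auto simp: starts_def rs(1))
    next
      case 3
      then show ?thesis using k rs(2) by (auto simp: starts_def)
    next
      case (4 j)
      then show ?thesis using k by (auto simp: starts_def rs(3)[simplified])
    qed
  qed
  also have "card \<dots> = card {i\<in>?S. i < k} + 1 + card {i\<in>?S. k \<le> i}"
    by (subst card_Un_disjoint, auto)+ (simp add: card_image inj_on_def)
  also have "card {i\<in>?S. i < k} + 1 + card {i\<in>?S. k \<le> i} = Suc (card ({i\<in>?S. i < k} \<union> {i\<in>?S. k \<le> i}))"
    by (subst card_Un_disjoint) auto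
  also have "{i\<in>?S. i < k} \<union> {i\<in>?S. k \<le> i} = ?S" by auto
  finally show ?thesis .
qed

text \<open>
  A label occurs at most twice, so the first of two adjacent equal cards is a first occurrence.
\<close>

lemma lucky_position_novel:
  assumes "count (mset d) (d ! k) \<le> 2" "Suc k < length d" "d ! k = d ! Suc k"
  shows "deck_word d ! k"
proof (rule ccontr)
  assume "\<not> deck_word d ! k"
  then have 1: "d ! k \<in> set (take k d)" using nth_novelty[of k d "{}"] assms by simp
  have "d = take k d @ d ! k # d ! Suc k # drop (k + 2) d"
    using assms by (metis Cons_nth_drop_Suc Suc_lessD add_2_eq_Suc' append_take_drop_id)
  then have "mset d = mset (take k d @ d ! k # d ! Suc k # drop (k + 2) d)" by simp
  then have "count (mset d) (d ! k) = count (mset (take k d)) (d ! k) + 2 + count (mset (drop (k + 2) d)) (d ! k)"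
    using assms(3) by simp
  moreover have "count (mset (take k d)) (d ! k) \<ge> 1" using 1
    by (metis One_nat_def Suc_leI count_greater_zero_iff set_mset_mset)
  ultimately show False using assms(1) by simp
qed

text \<open>
  Inserting a pair at a start cannot separate a lucky pair: the second card of a lucky pair is never a
  start.
\<close>

lemma card_lucky_positions_insert_pair:
  assumes "a \<notin> set d" "k \<in> starts (deck_word d)" "\<And>x. count (mset d) x \<le> 2"
  shows "card (lucky_positions (insert_pair k a d)) = Suc (card (lucky_positions d))"
proof -
  let ?S = "lucky_positions d"
  have k: "k \<le> length d" "round_start (deck_word d) k" using assms(2) by (auto simp: starts_def)
  note rs = round_start_insert_pair[OF assms(1) k(1)] and nth = nth_insert_pair[OF k(1)]
  have "lucky_positions (insert_pair k a d) = {i\<in>?S. i < k} \<union> {k} \<union> (\<lambda>i. i + 2) ` {i\<in>?S. k \<le> i}" (is "?L = ?R")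
  proof (rule set_eqI)
    fix i show "i \<in> ?L \<longleftrightarrow> i \<in> ?R"
    proof (cases i k rule: nat_cases_pair)
      case 1
      show ?thesis
      proof (cases "Suc i = k")
        case True
        \<comment> \<open>A lucky pair at \<open>k - 1\<close> would be torn apart by the insertion, but there is none in \<open>d\<close> either.\<close>
        have "i \<notin> ?L"
          using True k assms(1) nth_mem[of i d] by (auto simp: lucky_positions_def nth)
        moreover have "i \<notin> ?S"
        proof
          assume i: "i \<in> ?S"
          then have "deck_word d ! i"
            using lucky_position_novel[of d i] assms(3) by (auto simp: lucky_positions_def)
          then show False using i k(2) True by (auto simp: lucky_positions_def)
        qed
        ultimately show ?thesis using True by auto
      next
        case False
        with 1 have "Suc i < k" by simp
        then show ?thesis using k by (auto simp: lucky_positions_def rs(1) nth)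
      qed
    next
      case 2
      then show ?thesis using k by (auto simp: lucky_positions_def rs(1) nth)
    next
      case 3
      then show ?thesis using k rs(2) by (auto simp: lucky_positions_def)
    next
      case (4 j)
      then show ?thesis using k by (auto simp: lucky_positions_def rs(3)[simplified] nth)
    qed
  qed
  also have "card \<dots> = card {i\<in>?S. i < k} + 1 + card {i\<in>?S. k \<le> i}"
    by (subst card_Un_disjoint, auto)+ (simp add: card_image inj_on_def)
  also have "card {i\<in>?S. i < k} + 1 + card {i\<in>?S. k \<le> i} = Suc (card ({i\<in>?S. i < k} \<union> {i\<in>?S. k \<le> i}))"
    by (subst card_Un_disjoint) auto
  also have "{i\<in>?S. i < k} \<union> {i\<in>?S. k \<le> i} = ?S" by auto
  finally show ?thesis .
qed

text \<open>
  Decks with a marked lucky pair correspond bijectively to decks with one label less, that label, and a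
  marked start at which the pair is put back.
\<close>

lemma sum_decks_by_lucky_position:
  fixes f :: "'a list \<Rightarrow> real"
  assumes "finite A"
  shows "(\<Sum>d\<in>decks A. \<Sum>k\<in>lucky_positions d. f d) =
    (\<Sum>a\<in>A. \<Sum>d\<in>decks (A - {a}). \<Sum>k\<in>starts (deck_word d). f (insert_pair k a d))"
proof -
  let ?T = "SIGMA a:A. SIGMA d:decks (A - {a}). starts (deck_word d)"
  let ?g = "\<lambda>(a, d, k). (insert_pair k a d, k)"
  have notin: "a \<notin> set d" if "d \<in> decks (A - {a})" for a d
    using set_deck[OF _ that] assms(1) by auto
  have starts_le: "k \<le> length d" if "k \<in> starts (deck_word d)" for k and d :: "'a list"
    using that by (auto simp: starts_def)
  have inj: "inj_on ?g ?T"
  proof (rule inj_onI, clarsimp)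
    fix a a' :: 'a and d d' k
    assume *: "k \<in> starts (deck_word d)" "k \<in> starts (deck_word d')" and eq: "insert_pair k a d = insert_pair k a' d'"
    have "a = a'" using arg_cong[OF eq, of "\<lambda>x. x ! k"] by (simp add: nth_insert_pair starts_le[OF *(1)] starts_le[OF *(2)])
    moreover have "take k d = take k d' \<and> drop k d = drop k d'"
      using eq starts_le[OF *(1)] starts_le[OF *(2)] unfolding insert_pair_def by (simp add: append_eq_append_conv)
    then have "d = d'" by (metis append_take_drop_id)
    ultimately show "a = a' \<and> d = d'" by simp
  qed
  have img: "?g ` ?T = Sigma (decks A) lucky_positions"
  proof (intro equalityI subsetI)
    fix x assume "x \<in> ?g ` ?T"
    then obtain a d k where *: "a \<in> A" "d \<in> decks (A - {a})" "k \<in> starts (deck_word d)" "x = (insert_pair k a d, k)"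
      by auto
    have k: "k \<le> length d" "round_start (deck_word d) k" using *(3) by (auto simp: starts_def)
    have "insert_pair k a d \<in> decks A"
      using decks_remove_label[OF assms *(1) mset_insert_pair] *(2) by simp
    moreover have "k \<in> lucky_positions (insert_pair k a d)"
      using k round_start_insert_pair(1)[OF notin[OF *(2)] k(1), of k]
      by (simp add: lucky_positions_def nth_insert_pair)
    ultimately show "x \<in> Sigma (decks A) lucky_positions" using * by simp
  next
    fix x assume "x \<in> Sigma (decks A) lucky_positions"
    then obtain d k where x: "x = (d, k)" "d \<in> decks A" "k \<in> lucky_positions d" by auto
    then have k: "Suc k < length d" "round_start (deck_word d) k" "d ! k = d ! Suc k"
      by (auto simp: lucky_positions_def)
    define a e where "a = d ! k" and "e = take k d @ drop (k + 2) d"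
    have "d = take k d @ d ! k # d ! Suc k # drop (k + 2) d"
      using k by (metis Cons_nth_drop_Suc Suc_lessD add_2_eq_Suc' append_take_drop_id)
    then have d: "d = insert_pair k a e"
      using k by (simp add: insert_pair_def a_def e_def)
    have a: "a \<in> A" using set_deck[OF assms x(2)] k by (auto simp: a_def)
    have e: "e \<in> decks (A - {a})"
      using decks_remove_label[OF assms a mset_insert_pair, of k e] x(2) d by simp
    have "k \<le> length e" using k by (simp add: e_def)
    then have "k \<in> starts (deck_word e)"
      using round_start_insert_pair(1)[OF notin[OF e], of k k] k(2) d by (simp add: starts_def)
    then show "x \<in> ?g ` ?T" using a e d x(1) by (intro image_eqI[of _ _ "(a, e, k)"]) auto
  qed
  have "(\<Sum>d\<in>decks A. \<Sum>k\<in>lucky_positions d. f d) = (\<Sum>x\<in>Sigma (decks A) lucky_positions. f (fst x))"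
    by (subst sum.Sigma) (auto simp: case_prod_unfold)
  also have "\<dots> = sum ((\<lambda>x. f (fst x)) \<circ> ?g) ?T"
    unfolding img[symmetric] by (rule sum.reindex[OF inj])
  also have "\<dots> = (\<Sum>a\<in>A. \<Sum>d\<in>decks (A - {a}). \<Sum>k\<in>starts (deck_word d). f (insert_pair k a d))"
    using assms(1) by (simp add: sum.Sigma o_def case_prod_unfold)
  finally show ?thesis .
qed

text \<open>
  Mark a lucky pair on the left and a start on the right; \<open>L\<close> and \<open>S\<close> both grow by one when the pair is
  inserted. Keeping \<open>S\<close> as a second argument of \<open>h\<close> allows the identity to be applied repeatedly.
\<close>

lemma lucky_insertion_identity:
  fixes h :: "nat \<Rightarrow> nat \<Rightarrow> real"
  assumes "finite A"
  shows "(\<Sum>d\<in>decks A. real (card (lucky_positions d)) * h (card (lucky_positions d)) (card (starts (deck_word d)))) =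
    (\<Sum>a\<in>A. \<Sum>d\<in>decks (A - {a}). real (card (starts (deck_word d))) *
       h (Suc (card (lucky_positions d))) (Suc (card (starts (deck_word d)))))"
proof -
  have "(\<Sum>d\<in>decks A. real (card (lucky_positions d)) * h (card (lucky_positions d)) (card (starts (deck_word d)))) =
      (\<Sum>d\<in>decks A. \<Sum>k\<in>lucky_positions d. h (card (lucky_positions d)) (card (starts (deck_word d))))"
    by simp
  also have "\<dots> = (\<Sum>a\<in>A. \<Sum>d\<in>decks (A - {a}). \<Sum>k\<in>starts (deck_word d).
      h (card (lucky_positions (insert_pair k a d))) (card (starts (deck_word (insert_pair k a d)))))"
    by (rule sum_decks_by_lucky_position[OF assms])
  also have "\<dots> = (\<Sum>a\<in>A. \<Sum>d\<in>decks (A - {a}). \<Sum>k\<in>starts (deck_word d).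
      h (Suc (card (lucky_positions d))) (Suc (card (starts (deck_word d)))))"
  proof (intro sum.cong refl)
    fix a d k assume *: "a \<in> A" "d \<in> decks (A - {a})" "k \<in> starts (deck_word d)"
    have "a \<notin> set d" "count (mset d) x \<le> 2" for x
      using set_deck[OF _ *(2)] count_deck[OF _ *(2)] assms by auto
    with *(3) show "h (card (lucky_positions (insert_pair k a d))) (card (starts (deck_word (insert_pair k a d)))) =
        h (Suc (card (lucky_positions d))) (Suc (card (starts (deck_word d))))"
      by (simp add: card_starts_insert_pair card_lucky_positions_insert_pair)
  qed
  finally show ?thesis by simp
qed

section \<open>The random word of a deck\<close>

definition insert_at :: "nat \<Rightarrow> 'a \<Rightarrow> 'a list \<Rightarrow> 'a list" where
  "insert_at p x w = take p w @ x # drop p w"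

lemma insert_at_simps [simp]:
  "insert_at 0 x w = x # w"
  "insert_at (Suc p) x (y # w) = y # insert_at p x w"
  "length (insert_at p x w) = Suc (length w)"
  by (auto simp: insert_at_def)

text \<open>
  The mean of \<open>f\<close> over the words of uniformly random decks of \<open>n\<close> pairs (see \<open>sum_decks_word\<close>). The
  recursion adds a last card, whose label is not new, and inserts its match into a uniformly random
  gap, where it becomes the first occurrence of the label. As a functional on real-valued functions
  it is linear and monotone by plain induction.
\<close>

primrec word_mean :: "nat \<Rightarrow> (bool list \<Rightarrow> real) \<Rightarrow> real" where
  "word_mean 0 f = f []"
| "word_mean (Suc n) f =
     word_mean n (\<lambda>w. (\<Sum>p\<le>length w. f (insert_at p True w @ [False])) / (real (length w) + 1))"

lemma word_mean_const [simp]: "word_mean n (\<lambda>_. c) = c"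
proof (induction n)
  case (Suc n)
  have "(\<lambda>w :: bool list. (\<Sum>p\<le>length w. c) / (real (length w) + 1)) = (\<lambda>_. c)"
    by (auto simp: field_simps)
  with Suc show ?case by (simp only: word_mean.simps)
qed simp

lemma word_mean_add: "word_mean n (\<lambda>w. f w + g w) = word_mean n f + word_mean n g"
  by (induction n arbitrary: f g) (simp_all add: sum.distrib add_divide_distrib)

lemma word_mean_cmult: "word_mean n (\<lambda>w. c * f w) = c * word_mean n f"
  by (induction n arbitrary: f) (simp_all flip: sum_distrib_left times_divide_eq_right)

lemma word_mean_divide: "word_mean n (\<lambda>w. f w / c) = word_mean n f / c"
  using word_mean_cmult[of n "1 / c" f] by simp

lemma word_mean_diff: "word_mean n (\<lambda>w. f w - g w) = word_mean n f - word_mean n g"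
  using word_mean_add[of n f "\<lambda>w. (-1) * g w"] unfolding word_mean_cmult by simp

lemma word_mean_sum: "finite I \<Longrightarrow> word_mean n (\<lambda>w. \<Sum>i\<in>I. f i w) = (\<Sum>i\<in>I. word_mean n (f i))"
  by (induction I rule: finite_induct) (simp_all add: word_mean_add)

lemma word_mean_mono:
  assumes "\<And>w. length w = 2 * n \<Longrightarrow> f w \<le> g w"
  shows "word_mean n f \<le> word_mean n g"
  using assms
proof (induction n arbitrary: f g)
  case (Suc n)
  show ?case
    unfolding word_mean.simps
    by (intro Suc.IH divide_right_mono sum_mono Suc.prems) auto
qed simp

lemma word_mean_cong:
  assumes "\<And>w. length w = 2 * n \<Longrightarrow> f w = g w"
  shows "word_mean n f = word_mean n g"
  using assms by (intro antisym word_mean_mono) auto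

lemma word_mean_nonneg:
  assumes "\<And>w. length w = 2 * n \<Longrightarrow> 0 \<le> f w"
  shows "0 \<le> word_mean n f"
  using word_mean_mono[of n "\<lambda>_. 0" f] assms by simp

lemma word_mean_abs: "\<bar>word_mean n f\<bar> \<le> word_mean n (\<lambda>w. \<bar>f w\<bar>)"
proof -
  have "word_mean n f \<le> word_mean n (\<lambda>w. \<bar>f w\<bar>)" by (intro word_mean_mono) auto
  moreover have "word_mean n (\<lambda>w. - 1 * f w) \<le> word_mean n (\<lambda>w. \<bar>f w\<bar>)" by (intro word_mean_mono) auto
  then have "- word_mean n f \<le> word_mean n (\<lambda>w. \<bar>f w\<bar>)" unfolding word_mean_cmult by simp
  ultimately show ?thesis by linarith
qed

text \<open>
  The variance of \<open>f\<close> is non-negative.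
\<close>

lemma word_mean_power2_le: "(word_mean n f)\<^sup>2 \<le> word_mean n (\<lambda>w. (f w)\<^sup>2)"
proof -
  define c where "c = word_mean n f"
  have "0 \<le> word_mean n (\<lambda>w. (f w - c)\<^sup>2)" by (rule word_mean_nonneg) simp
  also have "(\<lambda>w. (f w - c)\<^sup>2) = (\<lambda>w. ((f w)\<^sup>2 - (2 * c) * f w) + c\<^sup>2)"
    by (simp add: power2_diff algebra_simps)
  also have "word_mean n \<dots> = word_mean n (\<lambda>w. (f w)\<^sup>2) - c\<^sup>2"
    by (simp only: word_mean_add word_mean_diff word_mean_cmult word_mean_const c_def[symmetric])
       (simp add: power2_eq_square)
  finally show ?thesis by (simp add: c_def)
qed

text \<open>
  The inserted card takes over the first occurrence of its label, so the last card becomes the second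
  one and no other entry of the word changes.
\<close>

lemma deck_word_insert_last:
  assumes "a \<notin> set d" "p \<le> length d"
  shows "deck_word (insert_at p a d @ [a]) = insert_at p True (deck_word d) @ [False]"
proof -
  have "a \<notin> set (take p d)" "a \<notin> set (drop p d)" using assms by (auto dest: in_set_takeD in_set_dropD)
  then show ?thesis
    by (simp add: insert_at_def novelty_append take_drop_novelty novelty_insert_irrelevant)
qed

text \<open>
  A deck is determined by its last label, the deck that remains when both cards of that label are
  removed, and the place of the match of the last card.
\<close>

lemma sum_decks_by_last_card:
  fixes f :: "'a list \<Rightarrow> real"
  assumes "finite A" "A \<noteq> {}"
  shows "sum f (decks A) = (\<Sum>a\<in>A. \<Sum>d\<in>decks (A - {a}). \<Sum>p\<le>length d. f (insert_at p a d @ [a]))"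
proof -
  let ?T = "SIGMA a:A. SIGMA d:decks (A - {a}). {..length d}"
  let ?g = "\<lambda>(a, d, p). insert_at p a d @ [a]"
  have notin: "a \<notin> set d" if "d \<in> decks (A - {a})" for a d
    using set_deck[OF _ that] assms(1) by auto
  have inj: "inj_on ?g ?T"
  proof (rule inj_onI, clarsimp)
    fix a d p e q
    assume d: "d \<in> decks (A - {a})" and p: "p \<le> length d"
      and e: "e \<in> decks (A - {a})" and q: "q \<le> length e" and eq: "insert_at p a d = insert_at q a e"
    have *: "remove1 a (insert_at p a d) = d \<and> length (takeWhile (\<lambda>x. x \<noteq> a) (insert_at p a d)) = p"
      if "a \<notin> set d" "p \<le> length d" for p d
    proof -
      have "a \<notin> set (take p d)" using that by (auto dest: in_set_takeD)
      then show ?thesis using that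
        by (auto simp: insert_at_def remove1_append takeWhile_append)
    qed
    show "d = e \<and> p = q" using *[OF notin[OF d] p] *[OF notin[OF e] q] eq by metis
  qed
  have img: "?g ` ?T = decks A"
  proof (intro equalityI subsetI)
    fix x assume "x \<in> ?g ` ?T"
    then obtain a d p where *: "a \<in> A" "d \<in> decks (A - {a})" "p \<le> length d" "x = insert_at p a d @ [a]"
      by auto
    have "mset x = mset (take p d @ drop p d) + {#a, a#}"
      unfolding *(4) insert_at_def mset_append by simp
    then show "x \<in> decks A" using decks_remove_label[OF assms(1) *(1), of x d] *(2) by simp
  next
    fix x assume x: "x \<in> decks A"
    then have "x \<noteq> []" using length_deck[OF x] assms by auto
    define a where "a = last x"
    have x_eq: "x = butlast x @ [a]" using \<open>x \<noteq> []\<close> by (simp add: a_def)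
    have a: "a \<in> A" using set_deck[OF assms(1) x] \<open>x \<noteq> []\<close> by (auto simp: a_def)
    have "count (mset (butlast x @ [a])) a = 2" using count_deck[OF assms(1) x, of a] x_eq a by simp
    then have "a \<in> set (butlast x)" by (auto simp flip: count_greater_zero_iff set_mset_mset)
    then obtain ys zs where yz: "butlast x = ys @ a # zs" by (meson split_list)
    have "mset x = mset (ys @ zs) + {#a, a#}" by (subst x_eq) (simp add: yz)
    then have "ys @ zs \<in> decks (A - {a})" using decks_remove_label[OF assms(1) a] x by blast
    moreover have "x = insert_at (length ys) a (ys @ zs) @ [a]"
      by (subst x_eq) (simp add: yz insert_at_def)
    ultimately show "x \<in> ?g ` ?T" using a by (intro image_eqI[of _ _ "(a, ys @ zs, length ys)"]) auto
  qed
  have "sum f (decks A) = sum (f \<circ> ?g) ?T"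
    unfolding img[symmetric] by (rule sum.reindex[OF inj])
  also have "\<dots> = (\<Sum>a\<in>A. \<Sum>d\<in>decks (A - {a}). \<Sum>p\<le>length d. f (insert_at p a d @ [a]))"
    using assms(1) by (simp add: sum.Sigma o_def case_prod_unfold)
  finally show ?thesis .
qed

lemma card_decks_rec:
  assumes "finite A" "card A = Suc n"
  shows "real (card (decks A)) = (2 * real n + 1) * (\<Sum>a\<in>A. real (card (decks (A - {a}))))"
proof -
  have "real (card (decks A)) = (\<Sum>d\<in>decks A. 1)" by simp
  also have "\<dots> = (\<Sum>a\<in>A. \<Sum>d\<in>decks (A - {a}). \<Sum>p\<le>length d. 1)"
    using assms by (intro sum_decks_by_last_card) auto
  also have "\<dots> = (\<Sum>a\<in>A. \<Sum>d\<in>decks (A - {a}). 2 * real n + 1)"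
    using assms by (intro sum.cong refl) (auto simp: length_deck)
  finally show ?thesis by (simp add: sum_distrib_left mult.commute)
qed

text \<open>
  The number of gaps is the same for all decks of a given size, so the uniform distribution on decks
  arises from inserting into uniform gaps.
\<close>

lemma sum_decks_word:
  assumes "finite A"
  shows "(\<Sum>d\<in>decks A. f (deck_word d)) = real (card (decks A)) * word_mean (card A) f"
  using assms
proof (induction "card A" arbitrary: A f)
  case 0
  then show ?case by simp
next
  case (Suc n)
  note A = \<open>finite A\<close> Suc.hyps(2)[symmetric]
  define h where "h = (\<lambda>w. \<Sum>p\<le>length w. f (insert_at p True w @ [False]))"
  have "(\<Sum>d\<in>decks A. f (deck_word d)) =
      (\<Sum>a\<in>A. \<Sum>d\<in>decks (A - {a}). \<Sum>p\<le>length d. f (deck_word (insert_at p a d @ [a])))"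
    using A by (intro sum_decks_by_last_card) auto
  also have "\<dots> = (\<Sum>a\<in>A. \<Sum>d\<in>decks (A - {a}). h (deck_word d))"
  proof (intro sum.cong refl)
    fix a d assume "d \<in> decks (A - {a})"
    then have "a \<notin> set d" using set_deck[of "A - {a}" d] A by auto
    then show "(\<Sum>p\<le>length d. f (deck_word (insert_at p a d @ [a]))) = h (deck_word d)"
      by (simp add: h_def deck_word_insert_last)
  qed
  also have "\<dots> = (\<Sum>a\<in>A. real (card (decks (A - {a}))) * word_mean n h)"
    using A by (intro sum.cong refl) (auto simp: Suc.hyps(1)[of "A - {_}" h])
  also have "\<dots> = (\<Sum>a\<in>A. real (card (decks (A - {a})))) * word_mean n h"
    by (simp add: sum_distrib_right)
  also have "\<dots> = real (card (decks A)) * (word_mean n h / (2 * real n + 1))"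
  proof -
    have "(2 * real n + 1) \<noteq> 0" by linarith
    then show ?thesis by (simp add: card_decks_rec[OF A])
  qed
  also have "word_mean n h / (2 * real n + 1) = word_mean n (\<lambda>w. h w / (2 * real n + 1))"
    by (simp add: word_mean_divide)
  also have "\<dots> = word_mean (card A) f"
    unfolding A(2) word_mean.simps by (rule word_mean_cong) (simp add: h_def)
  finally show ?case .
qed

section \<open>Runs of first occurrences\<close>

text \<open>
  The length of \<open>w\<close> is at least \<open>j\<close> in this case, since otherwise \<open>take j w\<close> is too short.
\<close>

definition leading :: "nat \<Rightarrow> bool list \<Rightarrow> bool" where
  "leading j w \<longleftrightarrow> take j w = replicate j True"

lemma leading_simps [simp]:
  "leading 0 w" "\<not> leading (Suc j) []" "leading (Suc j) (x # w) \<longleftrightarrow> x \<and> leading j w"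
  by (auto simp: leading_def)

definition runs :: "nat \<Rightarrow> bool list \<Rightarrow> nat" where
  "runs j w = card {k. k \<le> length w \<and> leading j (drop k w)}"

lemma runs_Nil: "runs j [] = of_bool (j = 0)"
  by (cases j) (auto simp: runs_def)

lemma runs_Cons: "runs j (x # w) = of_bool (leading j (x # w)) + runs j w"
proof -
  let ?K = "{k. k \<le> length w \<and> leading j (drop k w)}"
  have "{k. k \<le> length (x # w) \<and> leading j (drop k (x # w))} =
          (if leading j (x # w) then {0} else {}) \<union> Suc ` ?K" (is "?L = ?R")
  proof (rule set_eqI)
    fix k show "k \<in> ?L \<longleftrightarrow> k \<in> ?R" by (cases k) auto
  qed
  moreover have "card (Suc ` ?K) = card ?K" by (simp add: card_image)
  moreover have "finite ?K" by simp
  ultimately show ?thesis by (auto simp: runs_def card_insert_if)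
qed

lemma runs_0: "runs 0 w = Suc (length w)"
  by (induction w) (auto simp: runs_Nil runs_Cons)

lemma runs_le: "runs j w \<le> Suc (length w)"
  by (induction w) (auto simp: runs_Nil runs_Cons)

lemma leading_append_False: "leading j (w @ [False]) = leading j w"
  by (induction w arbitrary: j; case_tac j) auto

lemma runs_append_False: "runs (Suc j) (w @ [False]) = runs (Suc j) w"
  by (induction w)
     (auto simp: runs_Nil runs_Cons leading_append_False)

text \<open>
  An entry \<open>True\<close> inserted into one of the first \<open>j + 1\<close> gaps completes an initial run of \<open>j\<close>; inserted
  further to the right it leaves the first \<open>j + 1\<close> entries as they were.
\<close>

lemma sum_leading_insert_at:
  "(\<Sum>p\<le>length w. of_bool (leading (Suc j) (insert_at p True w)) :: real) =
     (real j + 1) * of_bool (leading j w) + (real (length w) - real j) * of_bool (leading (Suc j) w)"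
proof (induction w arbitrary: j)
  case Nil
  then show ?case by (cases j) auto
next
  case (Cons x w)
  show ?case
  proof (cases j)
    case 0
    then show ?thesis by (simp add: sum.atMost_Suc_shift del: sum.atMost_Suc)
  next
    case (Suc j')
    have "(\<Sum>p\<le>length (x # w). of_bool (leading (Suc j) (insert_at p True (x # w))) :: real) =
       of_bool (leading j (x # w)) + of_bool x * (\<Sum>p\<le>length w. of_bool (leading (Suc j') (insert_at p True w)))"
      by (simp add: sum.atMost_Suc_shift sum_distrib_left Suc of_bool_conj del: sum.atMost_Suc)
    then show ?thesis
      unfolding Cons.IH by (simp add: Suc algebra_simps of_bool_conj)
  qed
qed

text \<open>
  Count the windows of \<open>j + 1\<close> entries \<open>True\<close> after the insertion. Those that avoid the new entry were
  windows before, and each old one survives unless one of its \<open>j\<close> inner gaps is hit. Those that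
  contain it stem from a window of length \<open>j\<close>, with \<open>j + 1\<close> places for the new entry.
\<close>

lemma sum_runs_insert_at:
  "(\<Sum>p\<le>length w. real (runs (Suc j) (insert_at p True w))) =
     (real (length w) + 1 - real j) * real (runs (Suc j) w) + (real j + 1) * real (runs j w)"
proof (induction w)
  case Nil
  then show ?case by (cases j) (auto simp: runs_Nil runs_Cons)
next
  case (Cons x w)
  let ?l = "\<lambda>p. of_bool (leading (Suc j) (insert_at p True (x # w))) :: real"
  have "(\<Sum>p\<le>length (x # w). real (runs (Suc j) (insert_at p True (x # w)))) =
      real (runs (Suc j) (x # w)) + (\<Sum>p\<le>length w. real (runs (Suc j) (insert_at p True w)))
        + (\<Sum>p\<le>length (x # w). ?l p)"
    by (simp add: sum.atMost_Suc_shift runs_Cons[of _ _ "insert_at _ _ _"] runs_Cons[of _ True]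
       sum.distrib del: sum.atMost_Suc)
  then show ?case
    unfolding Cons.IH sum_leading_insert_at
    by (simp add: runs_Cons algebra_simps)
qed

lemma leading_insert_at_beyond: "j \<le> p \<Longrightarrow> p \<le> length w \<Longrightarrow> leading j (insert_at p x w) = leading j w"
  by (auto simp: leading_def insert_at_def)

lemma runs_insert_at_bound:
  assumes "p \<le> length w"
  shows "\<bar>real (runs j (insert_at p True w)) - real (runs j w)\<bar> \<le> real (min p j) + 1"
  using assms
proof (induction w arbitrary: p)
  case Nil
  then show ?case by (cases j) (auto simp: runs_Nil runs_Cons)
next
  case (Cons x w)
  show ?case
  proof (cases p)
    case 0
    then show ?thesis by (simp add: runs_Cons[of _ True])
  next
    case (Suc p')
    with Cons.prems have IH: "\<bar>real (runs j (insert_at p' True w)) - real (runs j w)\<bar> \<le> real (min p' j) + 1"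
      by (intro Cons.IH) auto
    have *: "leading j (x # insert_at p' True w) = leading j (x # w)" if "j \<le> p"
      using leading_insert_at_beyond[of j p "x # w" True] that Cons.prems Suc by simp
    show ?thesis
    proof (cases "j \<le> p")
      case True
      then show ?thesis using IH * by (simp add: Suc runs_Cons)
    next
      case False
      have "\<bar>of_bool (leading j (x # insert_at p' True w)) - of_bool (leading j (x # w)) :: real\<bar> \<le> 1"
        by auto
      then show ?thesis using IH False by (simp add: Suc runs_Cons)
    qed
  qed
qed

text \<open>
  The deviation of the number of windows from its approximate mean.
\<close>

definition run_dev :: "nat \<Rightarrow> bool list \<Rightarrow> real" where
  "run_dev j w = real (runs j w) - real (length w) / (real j + 1)"

lemma run_dev_0 [simp]: "run_dev 0 w = 1"
  by (simp add: run_dev_def runs_0)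

lemma run_dev_bound: "\<bar>run_dev j w\<bar> \<le> real (length w) + 1"
proof -
  have "real (length w) / (real j + 1) \<le> real (length w)"
    by (simp add: field_simps)
  moreover have "real (length w) / (real j + 1) \<ge> 0" by simp
  moreover have "real (runs j w) \<le> real (length w) + 1" using runs_le[of j w] by simp
  ultimately show ?thesis unfolding run_dev_def abs_le_iff by linarith
qed

text \<open>
  The drift of the squared deviation \<open>Y ^ 2\<close>, where \<open>Z\<close> is the deviation for windows shorter by one.
  The coefficient \<open>1 - j\<close> of \<open>Y\<close> is a restoring force: for \<open>j \<ge> 2\<close> it absorbs the \<open>Y\<close>-part of the
  mixed term \<open>2 * j * Y * Z\<close>. For \<open>j = 1\<close> there is no such force, but then \<open>Z\<close> is the constant
  1.
\<close>

lemma square_drift_bound: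
  fixes Y Z m j :: real
  assumes j: "j = 1 \<or> j \<ge> 2" and m: "m \<ge> 0" and Y: "\<bar>Y\<bar> \<le> m + 1" and Z: "j = 1 \<Longrightarrow> Z = 1"
  shows "2 * Y * ((1 - j) * Y + j * Z - 2 / (j + 1)) \<le> j * Z\<^sup>2 + 4 * (m + 1)"
proof -
  have a: "- (Y * (4 / (j + 1))) \<le> 2 * (m + 1)"
  proof -
    have "- (Y * (4 / (j + 1))) \<le> \<bar>Y\<bar> * (4 / (j + 1))"
      using j by (auto simp: minus_le_iff abs_if mult_nonneg_nonneg divide_simps)
    also have "\<dots> \<le> (m + 1) * 2"
      using Y j by (intro mult_mono) (auto simp: field_simps)
    finally show ?thesis by simp
  qed
  have b: "2 * Y * ((1 - j) * Y + j * Z) \<le> j * Z\<^sup>2 + 2 * (m + 1)"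
  proof (cases "j = 1")
    case True
    then show ?thesis using Y Z m by simp
  next
    case False
    with j have j2: "j \<ge> 2" by simp
    \<comment> \<open>completing the square turns the mixed term into \<open>Y ^ 2\<close> and \<open>Z ^ 2\<close>\<close>
    have "2 * Y * ((1 - j) * Y + j * Z) = (2 - j) * Y\<^sup>2 + j * Z\<^sup>2 - j * (Y - Z)\<^sup>2"
      by (simp add: power2_eq_square algebra_simps)
    also have "\<dots> \<le> j * Z\<^sup>2"
    proof -
      have "(2 - j) * Y\<^sup>2 \<le> 0" using j2 by (intro mult_nonpos_nonneg) auto
      moreover have "j * (Y - Z)\<^sup>2 \<ge> 0" using j2 by auto
      ultimately show ?thesis by linarith
    qed
    also have "\<dots> \<le> j * Z\<^sup>2 + 2 * (m + 1)" using m by simp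
    finally show ?thesis .
  qed
  have "2 * Y * ((1 - j) * Y + j * Z - 2 / (j + 1)) =
     2 * Y * ((1 - j) * Y + j * Z) - (Y * (4 / (j + 1)))"
    by (simp add: algebra_simps)
  then show ?thesis using a b by linarith
qed

text \<open>
  The centering \<open>length w / (j + 1)\<close> makes the terms proportional to the length cancel.
\<close>

lemma run_dev_insertion_drift:
  "(\<Sum>p\<le>length w. run_dev (Suc j) (insert_at p True w @ [False]) - run_dev (Suc j) w) =
     (1 - real (Suc j)) * run_dev (Suc j) w + real (Suc j) * run_dev j w - 2 / (real (Suc j) + 1)"
proof -
  have "(\<Sum>p\<le>length w. run_dev (Suc j) (insert_at p True w @ [False]) - run_dev (Suc j) w) =
     (\<Sum>p\<le>length w. real (runs (Suc j) (insert_at p True w)))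
       - (real (length w) + 1) * (real (runs (Suc j) w) + 2 / (real j + 2))"
    by (simp add: run_dev_def runs_append_False sum_subtractf sum.distrib add_divide_distrib algebra_simps)
  also have "\<dots> = - real j * real (runs (Suc j) w) + (real j + 1) * real (runs j w) - (real (length w) + 1) * (2 / (real j + 2))"
    unfolding sum_runs_insert_at by (simp add: algebra_simps)
  also have "\<dots> = (1 - real (Suc j)) * run_dev (Suc j) w + real (Suc j) * run_dev j w - 2 / (real (Suc j) + 1)"
    by (simp add: run_dev_def divide_simps) (simp add: algebra_simps)
  finally show ?thesis .
qed

text \<open>
  Expand the square around the old deviation: the linear term is controlled by the drift, the
  quadratic one by the bounded effect of a single insertion.
\<close>

lemma run_dev_square_step:
  assumes "length w = m"
  shows "(\<Sum>p\<le>m. (run_dev (Suc j) (insert_at p True w @ [False]))\<^sup>2) / (real m + 1) \<le>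
    (run_dev (Suc j) w)\<^sup>2 + real (Suc j) * ((run_dev j w)\<^sup>2 / (real m + 1)) + (4 + (real j + 4)\<^sup>2)"
proof -
  define y where "y = run_dev (Suc j) w"
  define D where "D = (\<lambda>p. run_dev (Suc j) (insert_at p True w @ [False]) - y)"
  have D: "(D p)\<^sup>2 \<le> (real j + 4)\<^sup>2" if "p \<le> m" for p
  proof -
    have "D p = real (runs (Suc j) (insert_at p True w)) - real (runs (Suc j) w) - 2 / (real j + 2)"
      by (simp add: D_def y_def run_dev_def runs_append_False add_divide_distrib algebra_simps)
    moreover have "\<bar>real (runs (Suc j) (insert_at p True w)) - real (runs (Suc j) w)\<bar> \<le> real (Suc j) + 1"
      using runs_insert_at_bound[of p w "Suc j"] that assms by simp
    moreover have "0 \<le> 2 / (real j + 2)" "2 / (real j + 2) \<le> 1" by (simp_all add: divide_le_eq)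
    ultimately have "\<bar>D p\<bar> \<le> real j + 4" by linarith
    then show ?thesis by (simp add: abs_le_square_iff[symmetric])
  qed
  have "(\<Sum>p\<le>m. (run_dev (Suc j) (insert_at p True w @ [False]))\<^sup>2) = (\<Sum>p\<le>m. y\<^sup>2 + 2 * y * D p + (D p)\<^sup>2)"
    by (rule sum.cong) (auto simp: D_def power2_eq_square algebra_simps)
  also have "\<dots> = (real m + 1) * y\<^sup>2 + 2 * y * (\<Sum>p\<le>m. D p) + (\<Sum>p\<le>m. (D p)\<^sup>2)"
    by (simp add: sum.distrib sum_distrib_left algebra_simps)
  also have "\<dots> \<le> (real m + 1) * y\<^sup>2 + (real (Suc j) * (run_dev j w)\<^sup>2 + 4 * (real m + 1)) + (real m + 1) * (real j + 4)\<^sup>2"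
  proof (intro add_mono order_refl)
    show "2 * y * (\<Sum>p\<le>m. D p) \<le> real (Suc j) * (run_dev j w)\<^sup>2 + 4 * (real m + 1)"
      unfolding D_def y_def assms[symmetric] run_dev_insertion_drift
      by (rule square_drift_bound) (use run_dev_bound[of "Suc j" w] in auto)
    show "(\<Sum>p\<le>m. (D p)\<^sup>2) \<le> (real m + 1) * (real j + 4)\<^sup>2"
      using sum_bounded_above[of "{..m}" "\<lambda>p. (D p)\<^sup>2" "(real j + 4)\<^sup>2"] D by (simp add: add.commute)
  qed
  finally have "(\<Sum>p\<le>m. (run_dev (Suc j) (insert_at p True w @ [False]))\<^sup>2) / (real m + 1) \<le>
      ((real m + 1) * y\<^sup>2 + (real (Suc j) * (run_dev j w)\<^sup>2 + 4 * (real m + 1)) + (real m + 1) * (real j + 4)\<^sup>2) / (real m + 1)"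
    by (rule divide_right_mono) simp
  also have "\<dots> = y\<^sup>2 + real (Suc j) * ((run_dev j w)\<^sup>2 / (real m + 1)) + (4 + (real j + 4)\<^sup>2)"
    by (simp add: divide_simps) (simp add: algebra_simps)
  finally show ?thesis by (simp only: y_def)
qed

text \<open>
  Each insertion adds to the second moment for \<open>j + 1\<close> a constant and a multiple of the second moment
  for \<open>j\<close> divided by the number of gaps; the latter is bounded by the induction hypothesis.
\<close>

lemma run_dev_second_moment:
  "\<exists>C>0. \<forall>n. word_mean n (\<lambda>w. (run_dev j w)\<^sup>2) \<le> C * (2 * real n + 1)"
proof (induction j)
  case 0
  show ?case by (intro exI[of _ 1]) auto
next
  case (Suc j)
  then obtain C where C: "C > 0" "\<And>n. word_mean n (\<lambda>w. (run_dev j w)\<^sup>2) \<le> C * (2 * real n + 1)"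
    by blast
  \<comment> \<open>\<open>K\<close> bounds the growth of the second moment in a single step, once the bound for \<open>j\<close> is inserted.\<close>
  define K where "K = real (Suc j) * C + (4 + (real j + 4)\<^sup>2)"
  have K: "K \<ge> 1" using C by (auto simp: K_def intro: add_increasing)
  have "word_mean n (\<lambda>w. (run_dev (Suc j) w)\<^sup>2) \<le> K * (2 * real n + 1)" for n
  proof (induction n)
    case 0
    have "run_dev (Suc j) [] = 0" by (simp add: run_dev_def runs_Nil)
    then show ?case using K by simp
  next
    case (Suc n)
    have "word_mean (Suc n) (\<lambda>w. (run_dev (Suc j) w)\<^sup>2) \<le>
       word_mean n (\<lambda>w. ((run_dev (Suc j) w)\<^sup>2 + real (Suc j) * ((run_dev j w)\<^sup>2 / (2 * real n + 1))) + (4 + (real j + 4)\<^sup>2))"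
      unfolding word_mean.simps
    proof (rule word_mean_mono)
      fix w :: "bool list" assume "length w = 2 * n"
      then show "(\<Sum>p\<le>length w. (run_dev (Suc j) (insert_at p True w @ [False]))\<^sup>2) / (real (length w) + 1) \<le>
        (run_dev (Suc j) w)\<^sup>2 + real (Suc j) * ((run_dev j w)\<^sup>2 / (2 * real n + 1)) + (4 + (real j + 4)\<^sup>2)"
        using run_dev_square_step[of w "2 * n" j] by simp
    qed
    also have "\<dots> = word_mean n (\<lambda>w. (run_dev (Suc j) w)\<^sup>2)
        + real (Suc j) * (word_mean n (\<lambda>w. (run_dev j w)\<^sup>2) / (2 * real n + 1)) + (4 + (real j + 4)\<^sup>2)"
      by (simp only: word_mean_add word_mean_cmult word_mean_divide word_mean_const)
    also have "\<dots> \<le> K * (2 * real n + 1) + real (Suc j) * C + (4 + (real j + 4)\<^sup>2)"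
    proof -
      have "word_mean n (\<lambda>w. (run_dev j w)\<^sup>2) / (2 * real n + 1) \<le> C"
        using C(2)[of n] by (simp add: divide_le_eq)
      then show ?thesis using Suc by (intro add_mono mult_left_mono) auto
    qed
    also have "\<dots> = K * (2 * real n + 1) + K" by (simp add: K_def)
    also have "\<dots> \<le> K * (2 * real (Suc n) + 1)" using K by (simp add: algebra_simps)
    finally show ?case .
  qed
  then show ?case using K by (intro exI[of _ K]) auto
qed

lemma run_density:
  "(\<lambda>n. word_mean n (\<lambda>w. \<bar>real (runs j w) / (2 * real n) - 1 / (real j + 1)\<bar>)) \<longlonglongrightarrow> 0"
proof -
  obtain C where C: "C > 0" "\<And>n. word_mean n (\<lambda>w. (run_dev j w)\<^sup>2) \<le> C * (2 * real n + 1)"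
    using run_dev_second_moment[of j] by blast
  have "(\<lambda>n. sqrt (C * (2 * real n + 1)) / (2 * real n)) \<longlonglongrightarrow> 0"
    using C(1) by real_asymp
  moreover have "word_mean n (\<lambda>w. \<bar>real (runs j w) / (2 * real n) - 1 / (real j + 1)\<bar>) \<le> sqrt (C * (2 * real n + 1)) / (2 * real n)"
    if "n > 0" for n
  proof -
    have "word_mean n (\<lambda>w. \<bar>real (runs j w) / (2 * real n) - 1 / (real j + 1)\<bar>) =
        word_mean n (\<lambda>w. \<bar>run_dev j w\<bar> / (2 * real n))"
    proof (rule word_mean_cong)
      fix w :: "bool list" assume w: "length w = 2 * n"
      have "real (runs j w) / (2 * real n) - 1 / (real j + 1) = run_dev j w / (2 * real n)"
        using w \<open>n > 0\<close> by (simp add: run_dev_def field_simps)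
      then show "\<bar>real (runs j w) / (2 * real n) - 1 / (real j + 1)\<bar> = \<bar>run_dev j w\<bar> / (2 * real n)"
        by simp
    qed
    also have "\<dots> = word_mean n (\<lambda>w. \<bar>run_dev j w\<bar>) / (2 * real n)" by (rule word_mean_divide)
    also have "word_mean n (\<lambda>w. \<bar>run_dev j w\<bar>) \<le> sqrt (C * (2 * real n + 1))"
      using word_mean_power2_le[of n "\<lambda>w. \<bar>run_dev j w\<bar>"] C(2)[of n]
      by (intro real_le_rsqrt) (auto simp: power2_abs)
    finally show ?thesis using that by (simp add: divide_right_mono)
  qed
  ultimately show ?thesis
    by - (rule Lim_null_comparison[OF eventually_mono[OF eventually_gt_at_top[of 0]]],
        simp_all add: word_mean_nonneg)
qed

section \<open>The density of round starts\<close>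

text \<open>
  Here windows are indexed by their right end, since the recursion for \<open>round_start\<close> looks back from a
  position.
\<close>

definition ends_run :: "bool list \<Rightarrow> nat \<Rightarrow> nat \<Rightarrow> bool" where
  "ends_run w j k \<longleftrightarrow> j \<le> k \<and> (\<forall>i\<in>{k - j..<k}. w ! i)"

lemma runs_eq_sum: "real (runs j w) = (\<Sum>k\<le>length w. of_bool (ends_run w j k))"
proof -
  have "leading j (drop k w) \<longleftrightarrow> k + j \<le> length w \<and> ends_run w j (k + j)" if "k \<le> length w" for k
  proof -
    have "leading j (drop k w) \<longleftrightarrow> k + j \<le> length w \<and> (\<forall>i<j. w ! (k + i))" 
      using that by (auto simp: leading_def list_eq_iff_nth_eq)
    also have "(\<forall>i<j. w ! (k + i)) \<longleftrightarrow> ends_run w j (k + j)"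
      unfolding ends_run_def
      by (auto; metis add.commute add_less_cancel_left le_add_diff_inverse )
    finally show ?thesis .
  qed
  then have "{k. k \<le> length w \<and> ends_run w j k} = (\<lambda>k. k + j) ` {k. k \<le> length w \<and> leading j (drop k w)}"
    by (auto simp: image_iff ends_run_def) (metis add_leD1 le_add_diff_inverse2 diff_le_self le_trans)
  then have "runs j w = card {k. k \<le> length w \<and> ends_run w j k}"
    by (simp add: runs_def card_image)
  also have "real \<dots> = (\<Sum>k\<le>length w. of_bool (ends_run w j k))"
    by (simp add: of_bool_def sum.If_cases Collect_conj_eq atMost_def)
  finally show ?thesis .
qed

text \<open>
  Unrolling \<open>s\<close> at \<open>k + 1\<close> as \<open>1 - s\<^sub>k * u\<^sub>k\<close> for \<open>J\<close> steps. At position 0 the unrolling stops by itself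
  because no longer window ends there.
\<close>

lemma round_start_expansion:
  "(of_bool (round_start w k) :: real) = (\<Sum>j<J. (-1) ^ j * of_bool (ends_run w j k))
      + (-1) ^ J * of_bool (ends_run w J k \<and> round_start w (k - J))"
proof (induction J)
  case 0
  then show ?case by (simp add: ends_run_def)
next
  case (Suc J)
  have "of_bool (ends_run w J k \<and> round_start w (k - J)) =
     (of_bool (ends_run w J k) - of_bool (ends_run w (Suc J) k \<and> round_start w (k - Suc J)) :: real)"
  proof (cases "J < k")
    case True
    then obtain i where i: "k - J = Suc i" "k - Suc J = i" by (metis Suc_diff_Suc)
    have "{k - Suc J..<k} = insert i {k - J..<k}" using i True by auto
    then have "ends_run w (Suc J) k \<longleftrightarrow> w ! i \<and> ends_run w J k"
      using True by (auto simp: ends_run_def)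
    then show ?thesis by (auto simp: i)
  next
    case False
    then show ?thesis by (auto simp: ends_run_def)
  qed
  then show ?case using Suc by simp
qed

text \<open>
  Sum the expansion over all positions; the remainder at \<open>k\<close> is non-zero only if a window of length \<open>J\<close>
  ends at \<open>k\<close>.
\<close>

lemma card_starts_bonferroni:
  "\<bar>real (card (starts w)) - (\<Sum>j<J. (-1) ^ j * real (runs j w))\<bar> \<le> real (runs J w)"
proof -
  have "real (card (starts w)) = (\<Sum>k\<le>length w. of_bool (round_start w k))"
    by (simp add: starts_def of_bool_def sum.If_cases Collect_conj_eq atMost_def)
  also have "\<dots> = (\<Sum>k\<le>length w. \<Sum>j<J. (-1) ^ j * of_bool (ends_run w j k))
      + (\<Sum>k\<le>length w. (-1) ^ J * of_bool (ends_run w J k \<and> round_start w (k - J)))"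
    by (subst round_start_expansion[where J = J]) (rule sum.distrib)
  also have "(\<Sum>k\<le>length w. \<Sum>j<J. (-1) ^ j * of_bool (ends_run w j k) :: real) =
      (\<Sum>j<J. (-1) ^ j * real (runs j w))"
    unfolding runs_eq_sum sum_distrib_left by (rule sum.swap)
  finally have "\<bar>real (card (starts w)) - (\<Sum>j<J. (-1) ^ j * real (runs j w))\<bar> =
      \<bar>\<Sum>k\<le>length w. (-1) ^ J * of_bool (ends_run w J k \<and> round_start w (k - J)) :: real\<bar>" by simp
  also have "\<dots> \<le> (\<Sum>k\<le>length w. \<bar>(-1) ^ J * of_bool (ends_run w J k \<and> round_start w (k - J)) :: real\<bar>)"
    by (rule sum_abs)
  also have "\<dots> \<le> (\<Sum>k\<le>length w. of_bool (ends_run w J k))"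
    by (intro sum_mono) (auto simp: abs_mult)
  finally show ?thesis by (simp add: runs_eq_sum)
qed

text \<open>
  For fixed \<open>J\<close> the truncated alternating sum of window densities tends to the partial sum of the
  alternating harmonic series, and the truncation error to at most \<open>1 / (J + 1)\<close>; then let \<open>J\<close> grow.
\<close>

lemma start_density:
  "(\<lambda>n. word_mean n (\<lambda>w. \<bar>real (card (starts w)) / (2 * real n) - ln 2\<bar>)) \<longlonglongrightarrow> 0"
proof (rule LIMSEQ_I)
  fix e :: real assume e: "e > 0"
  define h where "h = (\<lambda>J. \<Sum>j<J. (-1) ^ j / real (Suc j))"
  have "h \<longlonglongrightarrow> ln 2" using alternating_harmonic_series_sums by (simp add: sums_def h_def)
  then have "(\<lambda>J. 1 / (real J + 1) + \<bar>h J - ln 2\<bar>) \<longlonglongrightarrow> 0 + \<bar>ln 2 - ln 2\<bar>"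
    by (intro tendsto_intros) real_asymp
  then have "(\<lambda>J. 1 / (real J + 1) + \<bar>h J - ln 2\<bar>) \<longlonglongrightarrow> 0" by simp
  then obtain J where "norm (1 / (real J + 1) + \<bar>h J - ln 2\<bar> - 0) < e / 2"
    using e by (meson LIMSEQ_D half_gt_zero order_refl)
  then have J: "1 / (real J + 1) + \<bar>h J - ln 2\<bar> < e / 2" by simp
  define D where "D = (\<lambda>n j. word_mean n (\<lambda>w. \<bar>real (runs j w) / (2 * real n) - 1 / (real j + 1)\<bar>))"
  have "(\<lambda>n. \<Sum>j\<le>J. D n j) \<longlonglongrightarrow> 0"
    using tendsto_sum[of "{..J}" "\<lambda>j n. D n j" "\<lambda>_. 0"] run_density by (simp add: D_def)
  then obtain N where N: "\<And>n. n \<ge> N \<Longrightarrow> norm ((\<Sum>j\<le>J. D n j) - 0) < e / 2"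
    using e by (meson LIMSEQ_D half_gt_zero)
  have "word_mean n (\<lambda>w. \<bar>real (card (starts w)) / (2 * real n) - ln 2\<bar>) < e" if n: "n \<ge> N" for n
  proof -
    have "word_mean n (\<lambda>w. \<bar>real (card (starts w)) / (2 * real n) - ln 2\<bar>) \<le>
      word_mean n (\<lambda>w. (\<Sum>j\<le>J. \<bar>real (runs j w) / (2 * real n) - 1 / (real j + 1)\<bar>) + (1 / (real J + 1) + \<bar>h J - ln 2\<bar>))"
    proof (rule word_mean_mono)
      fix w :: "bool list"
      define r where "r = (\<lambda>j. real (runs j w) / (2 * real n))"
      define d where "d = (\<lambda>j. \<bar>r j - 1 / (real j + 1)\<bar>)"
      have "\<bar>real (card (starts w)) / (2 * real n) - (\<Sum>j<J. (-1) ^ j * r j)\<bar>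
         = \<bar>real (card (starts w)) - (\<Sum>j<J. (-1) ^ j * real (runs j w))\<bar> / (2 * real n)"
      proof -
        have "(\<Sum>j<J. (-1) ^ j * r j) = (\<Sum>j<J. (-1) ^ j * real (runs j w)) / (2 * real n)"
          by (simp add: r_def sum_divide_distrib)
        then show ?thesis by (simp add: abs_divide flip: diff_divide_distrib)
      qed
      also have "\<dots> \<le> r J"
        unfolding r_def by (intro divide_right_mono card_starts_bonferroni) simp
      also have "\<dots> \<le> 1 / (real J + 1) + d J" by (simp add: d_def)
      finally have a: "\<bar>real (card (starts w)) / (2 * real n) - (\<Sum>j<J. (-1) ^ j * r j)\<bar> \<le> 1 / (real J + 1) + d J" .
      have "\<bar>(\<Sum>j<J. (-1) ^ j * r j) - h J\<bar> = \<bar>\<Sum>j<J. (-1) ^ j * (r j - 1 / (real j + 1))\<bar>"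
        by (simp add: h_def sum_subtractf[symmetric] algebra_simps)
      also have "\<dots> \<le> (\<Sum>j<J. \<bar>(-1) ^ j * (r j - 1 / (real j + 1))\<bar>)" by (rule sum_abs)
      also have "\<dots> = (\<Sum>j<J. d j)" by (simp add: d_def abs_mult)
      finally have b: "\<bar>(\<Sum>j<J. (-1) ^ j * r j) - h J\<bar> \<le> (\<Sum>j<J. d j)" .
      have "(\<Sum>j\<le>J. d j) = (\<Sum>j<J. d j) + d J" by (simp add: lessThan_Suc_atMost[symmetric])
      then have "\<bar>real (card (starts w)) / (2 * real n) - ln 2\<bar> \<le> (\<Sum>j\<le>J. d j) + (1 / (real J + 1) + \<bar>h J - ln 2\<bar>)"
        using a b by linarith
      then show "\<bar>real (card (starts w)) / (2 * real n) - ln 2\<bar> \<le>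
         (\<Sum>j\<le>J. \<bar>real (runs j w) / (2 * real n) - 1 / (real j + 1)\<bar>) + (1 / (real J + 1) + \<bar>h J - ln 2\<bar>)"
        by (simp add: d_def r_def)
    qed
    also have "\<dots> = (\<Sum>j\<le>J. D n j) + (1 / (real J + 1) + \<bar>h J - ln 2\<bar>)"
      by (simp only: word_mean_add word_mean_const word_mean_sum finite_atMost D_def)
    also have "\<dots> < e / 2 + e / 2" using J N[OF n] by (intro add_strict_mono) auto
    finally show ?thesis by simp
  qed
  moreover have "0 \<le> word_mean n (\<lambda>w. \<bar>real (card (starts w)) / (2 * real n) - ln 2\<bar>)" for n
    by (rule word_mean_nonneg) simp
  ultimately show "\<exists>no. \<forall>n\<ge>no. norm (word_mean n (\<lambda>w. \<bar>real (card (starts w)) / (2 * real n) - ln 2\<bar>) - 0) < e"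
    by (intro exI[of _ N]) auto
qed

section \<open>Mixed moments of lucky pairs and round starts\<close>

text \<open>
  All factors \<open>(S + i) / (2 * n)\<close> are bounded and tend to \<open>ln 2\<close> in mean, hence so does their product to
  the power of \<open>ln 2\<close>.
\<close>

lemma pochhammer_starts_limit:
  "(\<lambda>n. word_mean n (\<lambda>w. pochhammer (real (card (starts w))) q) / (2 * real n) ^ q) \<longlonglongrightarrow> ln 2 ^ q"
proof -
  define P where "P = (\<lambda>n w q. pochhammer (real (card (starts w))) q / (2 * real n) ^ q)"
  define E where "E = (\<lambda>n q. word_mean n (\<lambda>w. \<bar>P n w q - ln 2 ^ q\<bar>))"
  have E_nonneg: "0 \<le> E n q" for n q
    unfolding E_def by (rule word_mean_nonneg) simp
  have "(\<lambda>n. E n q) \<longlonglongrightarrow> 0"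
  proof (induction q)
    case 0
    then show ?case by (simp add: E_def P_def)
  next
    case (Suc q)
    define S where "S = (\<lambda>n. word_mean n (\<lambda>w. \<bar>real (card (starts w)) / (2 * real n) - ln 2\<bar>))"
    have lim: "(\<lambda>n. (real q + 2) * E n q + (ln 2) ^ q * (S n + real q / (2 * real n))) \<longlonglongrightarrow> 
        (real q + 2) * 0 + (ln 2) ^ q * (0 + 0)"
      by (intro tendsto_intros Suc start_density[folded S_def]) real_asymp
    have "E n (Suc q) \<le> (real q + 2) * E n q + (ln 2) ^ q * (S n + real q / (2 * real n))" if "n > 0" for n
    proof -
      have "E n (Suc q) \<le> word_mean n (\<lambda>w. (real q + 2) * \<bar>P n w q - ln 2 ^ q\<bar>
           + (ln 2) ^ q * (\<bar>real (card (starts w)) / (2 * real n) - ln 2\<bar> + real q / (2 * real n)))"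
        unfolding E_def
      proof (rule word_mean_mono)
        fix w :: "bool list" assume w: "length w = 2 * n"
        define b where "b = (real (card (starts w)) + real q) / (2 * real n)"
        have P: "P n w (Suc q) = P n w q * b"
          by (simp add: P_def b_def pochhammer_Suc)
        have "real (card (starts w)) \<le> 2 * real n + 1"
          using card_starts_le[of w] w by simp
        then have "b \<le> (2 * real n + 1 + real q) / (2 * real n)"
          unfolding b_def by (intro divide_right_mono) auto
        also have "\<dots> \<le> real q + 2"
        proof -
          have "1 + real q \<le> (real q + 1) * (2 * real n)" using that mult_left_mono[of 1 "2 * real n" "real q + 1"] by (simp add: add.commute)
          then show ?thesis using that by (simp add: divide_le_eq algebra_simps)
        qed
        finally have b: "\<bar>b\<bar> \<le> real q + 2" by (simp add: b_def)
        have b': "\<bar>b - ln 2\<bar> \<le> \<bar>real (card (starts w)) / (2 * real n) - ln 2\<bar> + real q / (2 * real n)"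
          using abs_triangle_ineq[of "real (card (starts w)) / (2 * real n) - ln 2" "real q / (2 * real n)"]
          by (simp add: b_def add_divide_distrib algebra_simps)
        have "P n w (Suc q) - ln 2 ^ Suc q = (P n w q - ln 2 ^ q) * b + ln 2 ^ q * (b - ln 2)"
          by (simp add: P algebra_simps)
        then have "\<bar>P n w (Suc q) - ln 2 ^ Suc q\<bar> \<le> \<bar>(P n w q - ln 2 ^ q) * b\<bar> + \<bar>ln 2 ^ q * (b - ln 2)\<bar>"
          by simp
        also have "\<dots> = \<bar>b\<bar> * \<bar>P n w q - ln 2 ^ q\<bar> + ln 2 ^ q * \<bar>b - ln 2\<bar>"
          by (simp add: abs_mult)
        also have "\<dots> \<le> (real q + 2) * \<bar>P n w q - ln 2 ^ q\<bar>
           + (ln 2) ^ q * (\<bar>real (card (starts w)) / (2 * real n) - ln 2\<bar> + real q / (2 * real n))"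
          using b b' by (intro add_mono mult_right_mono mult_left_mono) auto
        finally show "\<bar>P n w (Suc q) - ln 2 ^ Suc q\<bar> \<le> (real q + 2) * \<bar>P n w q - ln 2 ^ q\<bar>
           + (ln 2) ^ q * (\<bar>real (card (starts w)) / (2 * real n) - ln 2\<bar> + real q / (2 * real n))" .
      qed
      then show ?thesis
        by (simp only: word_mean_add word_mean_cmult word_mean_const E_def S_def)
    qed
    then show ?case
      using lim E_nonneg
      by - (rule Lim_null_comparison[OF eventually_mono[OF eventually_gt_at_top[of 0]]], simp_all)
  qed
  moreover have "\<bar>word_mean n (\<lambda>w. P n w q) - ln 2 ^ q\<bar> \<le> E n q" for n
    using word_mean_abs[of n "\<lambda>w. P n w q - ln 2 ^ q"]
    by (simp add: word_mean_diff E_def)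
  ultimately have "(\<lambda>n. word_mean n (\<lambda>w. P n w q) - ln 2 ^ q) \<longlonglongrightarrow> 0"
    by - (rule Lim_null_comparison[of _ "\<lambda>n. E n q"], simp_all)
  then have "(\<lambda>n. word_mean n (\<lambda>w. P n w q)) \<longlonglongrightarrow> ln 2 ^ q"
    by (simp add: LIM_zero_iff)
  then show ?thesis by (simp add: P_def word_mean_divide)
qed

text \<open>
  The mean of \<open>(L choose r) * (S * (S + 1) * ... * (S + q - 1))\<close> over decks of \<open>n\<close> pairs. The last equation
  trades one lucky pair for one more factor of the rising product. The weight \<open>q\<close> is what makes the
  recursion close: each insertion of a pair shifts \<open>S\<close> by one.
\<close>

fun joint_moment :: "nat \<Rightarrow> nat \<Rightarrow> nat \<Rightarrow> real" where
  "joint_moment 0 n q = word_mean n (\<lambda>w. pochhammer (real (card (starts w))) q)"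
| "joint_moment (Suc r) 0 q = 0"
| "joint_moment (Suc r) (Suc n) q = joint_moment r n (Suc q) / ((real r + 1) * (2 * real n + 1))"

lemma sum_decks_joint_moment:
  assumes "finite A"
  shows "(\<Sum>d\<in>decks A. real (card (lucky_positions d) choose r) * pochhammer (real (card (starts (deck_word d)))) q) =
    real (card (decks A)) * joint_moment r (card A) q"
  using assms
proof (induction r arbitrary: A q)
  case 0
  then show ?case
    using sum_decks_word[of A "\<lambda>w. pochhammer (real (card (starts w))) q"] by simp
next
  case (Suc r)
  show ?case
  proof (cases "card A")
    case 0
    then have "A = {}" using Suc.prems by simp
    then show ?thesis by (simp add: lucky_positions_def)
  next
    case (Suc n)
    let ?L = "\<lambda>d :: 'a list. card (lucky_positions d)" and ?S = "\<lambda>d :: 'a list. card (starts (deck_word d))"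
    \<comment> \<open>chosen so that \<open>L * h(L, S)\<close> is \<open>(r + 1) * (L choose (r + 1))\<close> times the rising product\<close>
    define h where "h = (\<lambda>l s. real ((l - 1) choose r) * pochhammer (real s) q)"
    have "(real r + 1) * (\<Sum>d\<in>decks A. real (?L d choose Suc r) * pochhammer (real (?S d)) q) =
        (\<Sum>d\<in>decks A. real (?L d) * h (?L d) (?S d))"
      unfolding sum_distrib_left
    proof (rule sum.cong)
      fix d
      have "real (Suc r * (?L d choose Suc r)) = real (?L d * ((?L d - 1) choose r))"
        by (simp only: binomial_absorption)
      then have *: "(real r + 1) * real (?L d choose Suc r) = real (?L d) * real ((?L d - 1) choose r)"
        by (simp only: of_nat_mult of_nat_Suc add.commute)
      then show "(real r + 1) * (real (?L d choose Suc r) * pochhammer (real (?S d)) q) = real (?L d) * h (?L d) (?S d)"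
        by (simp only: h_def * mult.assoc[symmetric])
    qed simp
    also have "\<dots> = (\<Sum>a\<in>A. \<Sum>d\<in>decks (A - {a}). real (?S d) * h (Suc (?L d)) (Suc (?S d)))"
      by (rule lucky_insertion_identity[OF Suc.prems])
    also have "\<dots> = (\<Sum>a\<in>A. \<Sum>d\<in>decks (A - {a}). real (?L d choose r) * pochhammer (real (?S d)) (Suc q))"
      by (simp add: h_def pochhammer_rec algebra_simps)
    also have "\<dots> = (\<Sum>a\<in>A. real (card (decks (A - {a}))) * joint_moment r n (Suc q))"
      using Suc.prems Suc by (intro sum.cong refl) (subst Suc.IH, auto)
    also have "\<dots> = (\<Sum>a\<in>A. real (card (decks (A - {a})))) * joint_moment r n (Suc q)"
      by (simp add: sum_distrib_right)
    finally have eq: "(real r + 1) * (\<Sum>d\<in>decks A. real (?L d choose Suc r) * pochhammer (real (?S d)) q) =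
       (\<Sum>a\<in>A. real (card (decks (A - {a})))) * joint_moment r n (Suc q)" .
    have pos: "real r + 1 \<noteq> 0" "2 * real n + 1 \<noteq> 0" by linarith+
    have "(\<Sum>d\<in>decks A. real (?L d choose Suc r) * pochhammer (real (?S d)) q) =
       (\<Sum>a\<in>A. real (card (decks (A - {a})))) * joint_moment r n (Suc q) / (real r + 1)"
      using eq pos(1) by (simp only: eq_divide_eq mult.commute[of "real r + 1"] if_False not_False_eq_True if_True)
    also have "\<dots> = real (card (decks A)) * joint_moment (Suc r) (card A) q"
      unfolding Suc card_decks_rec[OF Suc.prems Suc] using pos by simp
    finally show ?thesis .
  qed
qed

text \<open>
  Normalised by \<open>(2 * n) ^ q\<close>, a step of the recursion multiplies by a factor that tends to
  \<open>1 / (r + 1)\<close>.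
\<close>

lemma joint_moment_limit:
  "(\<lambda>n. joint_moment r n q / (2 * real n) ^ q) \<longlonglongrightarrow> ln 2 ^ (r + q) / fact r"
proof (induction r arbitrary: q)
  case 0
  then show ?case using pochhammer_starts_limit by simp
next
  case (Suc r)
  \<comment> \<open>the factor between the normalised moments on both sides of the recursion\<close>
  define c where "c = (\<lambda>n. (2 * real n) / (2 * real n + 1) * ((2 * real n) / (2 * real n + 2)) ^ q / (real r + 1))"
  have "c \<longlonglongrightarrow> 1 * 1 ^ q / (real r + 1)"
    unfolding c_def by (intro tendsto_intros) (real_asymp, real_asymp, simp)
  then have lim: "(\<lambda>n. joint_moment r n (Suc q) / (2 * real n) ^ Suc q * c n) \<longlonglongrightarrow>
      (ln 2 ^ (r + Suc q) / fact r) * (1 * 1 ^ q / (real r + 1))"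
    by (intro tendsto_mult Suc)
  have eq: "(ln 2 ^ (r + Suc q) / fact r) * (1 * 1 ^ q / (real r + 1)) = (ln 2 ^ (Suc r + q) / fact (Suc r) :: real)"
    by (simp add: field_simps)
  have "joint_moment r n (Suc q) / (2 * real n) ^ Suc q * c n = joint_moment (Suc r) (Suc n) q / (2 * real (Suc n)) ^ q"
    if "n > 0" for n
  proof -
    have "2 * real (Suc n) = 2 * real n + 2" by simp
    then show ?thesis using that by (simp only: joint_moment.simps) (simp add: c_def power_divide field_simps)
  qed
  then have "(\<lambda>n. joint_moment (Suc r) (Suc n) q / (2 * real (Suc n)) ^ q) \<longlonglongrightarrow> ln 2 ^ (Suc r + q) / fact (Suc r)"
    by (rule Lim_transform_eventually[OF lim[unfolded eq] eventually_mono[OF eventually_gt_at_top[of 0]]])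
  then show ?case by (rule LIMSEQ_imp_Suc)
qed

lemma pochhammer_of_nat_mono:
  "m \<le> n \<Longrightarrow> pochhammer (real m) q \<le> pochhammer (real n) q"
  unfolding pochhammer_prod by (intro prod_mono) auto

text \<open>
  There are at most \<open>2 * n + 1\<close> starts. In the recursion the factor \<open>2 * n + 1\<close> of the rising product is
  exactly the denominator, so at \<open>q = 0\<close> the bound is \<open>1 / r!\<close> whatever \<open>n\<close> is.
\<close>

lemma joint_moment_bounds:
  "0 \<le> joint_moment r n q" "joint_moment r n q \<le> pochhammer (2 * real n + 1) q / fact r"
proof -
  have "0 \<le> joint_moment r n q \<and> joint_moment r n q \<le> pochhammer (2 * real n + 1) q / fact r"
  proof (induction r n q rule: joint_moment.induct)
    case (1 n q)
    have "word_mean n (\<lambda>w. pochhammer (real (card (starts w))) q) \<le> word_mean n (\<lambda>_. pochhammer (real (2 * n + 1)) q)"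
      by (rule word_mean_mono, rule pochhammer_of_nat_mono) (metis Suc_eq_plus1 card_starts_le)
    moreover have "0 \<le> word_mean n (\<lambda>w. pochhammer (real (card (starts w))) q)"
      by (rule word_mean_nonneg) (simp add: pochhammer_of_nat)
    ultimately show ?case by (simp add: add.commute)
  next
    case (2 r q)
    then show ?case by (simp add: pochhammer_nonneg)
  next
    case (3 r n q)
    let ?x = "2 * real n + 1"
    have pos: "(real r + 1) * ?x > 0" by (intro mult_pos_pos) linarith+
    have "joint_moment r n (Suc q) / ((real r + 1) * ?x) \<le> (pochhammer ?x (Suc q) / fact r) / ((real r + 1) * ?x)"
      using 3 pos by (intro divide_right_mono) auto
    also have "\<dots> = pochhammer (?x + 1) q / fact (Suc r)"
    proof -
      have "(x * P / f) / ((real r + 1) * x) = P / ((real r + 1) * f)" if "x \<noteq> 0" for x P f :: real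
        using that by simp
      moreover have "?x \<noteq> 0" by linarith
      ultimately show ?thesis unfolding pochhammer_rec by (simp add: add.commute[of 1])
    qed
    also have "\<dots> \<le> pochhammer (2 * real (Suc n) + 1) q / fact (Suc r)"
      using pochhammer_of_nat_mono[of "2 * n + 2" "2 * n + 3" q]
      by (intro divide_right_mono) (simp_all add: algebra_simps)
    finally show ?case using 3 pos by simp
  qed
  then show "0 \<le> joint_moment r n q" "joint_moment r n q \<le> pochhammer (2 * real n + 1) q / fact r" by auto
qed

lemma joint_moment_eq_0: "n < r \<Longrightarrow> joint_moment r n q = 0"
  by (induction r n q rule: joint_moment.induct) auto

section \<open>Poisson limit\<close>

lemma decks_nonempty: "finite A \<Longrightarrow> decks A \<noteq> {}"
  by (simp add: decks_def permutations_of_multiset_def ex_mset)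

text \<open>
  Expand \<open>z ^ L = ((z - 1) + 1) ^ L\<close> by the binomial theorem; the series is in fact a finite sum.
\<close>

lemma generating_function_lucky:
  fixes z :: complex
  assumes "finite A"
  shows "(\<Sum>d\<in>decks A. z ^ card (lucky_positions d)) / of_nat (card (decks A)) =
    (\<Sum>r. of_real (joint_moment r (card A) 0) * (z - 1) ^ r)"
proof -
  let ?L = "\<lambda>d. card (lucky_positions d)"
  define N where "N = 2 * card A"
  have "z ^ ?L d = (\<Sum>r\<le>N. of_nat (?L d choose r) * (z - 1) ^ r)" if "d \<in> decks A" for d
  proof -
    have "?L d \<le> N"
    proof -
      have "lucky_positions d \<subseteq> {..<length d}" by (auto simp: lucky_positions_def)
      then have "?L d \<le> card {..<length d}" by (intro card_mono) auto
      then show ?thesis using length_deck[OF that] by (simp add: N_def)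
    qed
    have "z ^ ?L d = ((z - 1) + 1) ^ ?L d" by simp
    also have "\<dots> = (\<Sum>r\<le>?L d. of_nat (?L d choose r) * (z - 1) ^ r)"
      by (subst binomial_ring) simp
    also have "\<dots> = (\<Sum>r\<le>N. of_nat (?L d choose r) * (z - 1) ^ r)"
      using \<open>?L d \<le> N\<close> by (intro sum.mono_neutral_left) auto
    finally show ?thesis .
  qed
  then have "(\<Sum>d\<in>decks A. z ^ ?L d) = (\<Sum>d\<in>decks A. \<Sum>r\<le>N. of_nat (?L d choose r) * (z - 1) ^ r)"
    by simp
  also have "\<dots> = (\<Sum>r\<le>N. (\<Sum>d\<in>decks A. of_nat (?L d choose r)) * (z - 1) ^ r)"
    by (subst sum.swap) (simp add: sum_distrib_right)
  also have "\<dots> = (\<Sum>r\<le>N. of_nat (card (decks A)) * (of_real (joint_moment r (card A) 0) * (z - 1) ^ r))"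
  proof (rule sum.cong)
    fix r
    have "(\<Sum>d\<in>decks A. of_nat (?L d choose r)) = complex_of_real (\<Sum>d\<in>decks A. real (?L d choose r))"
      by simp
    also have "(\<Sum>d\<in>decks A. real (?L d choose r)) = real (card (decks A)) * joint_moment r (card A) 0"
      using sum_decks_joint_moment[OF assms, of r 0] by simp
    finally show "(\<Sum>d\<in>decks A. of_nat (?L d choose r)) * (z - 1) ^ r =
        of_nat (card (decks A)) * (of_real (joint_moment r (card A) 0) * (z - 1) ^ r)" by simp
  qed simp
  also have "\<dots> = of_nat (card (decks A)) * (\<Sum>r\<le>N. of_real (joint_moment r (card A) 0) * (z - 1) ^ r)"
    by (simp add: sum_distrib_left)
  also have "(\<Sum>r\<le>N. of_real (joint_moment r (card A) 0) * (z - 1) ^ r) =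
      (\<Sum>r. of_real (joint_moment r (card A) 0) * (z - 1) ^ r)"
    by (rule suminf_finite[symmetric]) (auto simp: N_def joint_moment_eq_0)
  finally show ?thesis using decks_nonempty[OF assms] by simp
qed

text \<open>
  Tannery's theorem with the majorant \<open>\<bar>z - 1\<bar> ^ r / r!\<close>.
\<close>

lemma generating_function_limit:
  fixes z :: complex
  shows "(\<lambda>n. \<Sum>r. of_real (joint_moment r n 0) * (z - 1) ^ r) \<longlonglongrightarrow> exp (of_real (ln 2) * (z - 1))"
proof -
  let ?a = "\<lambda>r n. complex_of_real (joint_moment r n 0) * (z - 1) ^ r"
  let ?b = "\<lambda>r. complex_of_real (ln 2 ^ r / fact r) * (z - 1) ^ r"
  have "(\<lambda>n. ?a r n) \<longlonglongrightarrow> ?b r" for r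
    using joint_moment_limit[of r 0] by (intro tendsto_intros) simp
  moreover have "norm (?a r n) \<le> norm (z - 1) ^ r / fact r" for r n
  proof -
    have "norm (?a r n) = joint_moment r n 0 * norm (z - 1) ^ r"
      using joint_moment_bounds(1) by (simp add: norm_mult norm_power)
    also have "\<dots> \<le> (1 / fact r) * norm (z - 1) ^ r"
      using joint_moment_bounds(2)[of r n 0] by (intro mult_right_mono) auto
    finally show ?thesis by simp
  qed
  moreover have "summable (\<lambda>r. norm (z - 1) ^ r / fact r)"
    using summable_exp[of "norm (z - 1)"] by (simp add: field_simps)
  ultimately have "(\<lambda>n. \<Sum>r. ?a r n) \<longlonglongrightarrow> suminf ?b"
    using tannerys_theorem[of ?a ?b sequentially "\<lambda>r. norm (z - 1) ^ r / fact r"]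
    by (simp add: always_eventually)
  also have "suminf ?b = exp (of_real (ln 2) * (z - 1))"
  proof -
    have "?b = (\<lambda>r. (of_real (ln 2) * (z - 1)) ^ r /\<^sub>R fact r)"
      by (simp only: power_mult_distrib scaleR_conv_of_real of_real_divide of_real_power of_real_inverse divide_inverse mult_ac of_real_mult)
    then show ?thesis by (simp only: exp_def)
  qed
  finally show ?thesis .
qed

lemma char_lucky_moves:
  "char (distr (measure_pmf (random_deck n)) borel (\<lambda>d. real (lucky_moves d))) t =
     (\<Sum>r. of_real (joint_moment r n 0) * (iexp t - 1) ^ r)"
proof -
  let ?A = "{1..n} :: nat set"
  have rd: "random_deck n = pmf_of_set (decks ?A)"
    by (simp add: random_deck_def decks_def)
  have "char (distr (measure_pmf (random_deck n)) borel (\<lambda>d. real (lucky_moves d))) t =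
      (CLINT d|measure_pmf (random_deck n). iexp t ^ lucky_moves d)"
    by (simp add: char_def integral_distr exp_of_nat_mult[symmetric] mult_ac)
  also have "\<dots> = (\<Sum>d\<in>decks ?A. pmf (random_deck n) d *\<^sub>R iexp t ^ lucky_moves d)"
    by (rule integral_measure_pmf) (simp_all add: rd decks_nonempty)
  also have "\<dots> = (\<Sum>d\<in>decks ?A. iexp t ^ card (lucky_positions d)) / of_nat (card (decks ?A))"
    unfolding sum_divide_distrib
    by (intro sum.cong refl) (simp add: rd decks_nonempty scaleR_conv_of_real lucky_moves_deck[of ?A])
  also have "\<dots> = (\<Sum>r. of_real (joint_moment r n 0) * (iexp t - 1) ^ r)"
    by (subst generating_function_lucky) simp_all
  finally show ?thesis .
qed

lemma char_poisson:
  assumes "0 < l"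
  shows "char (distr (measure_pmf (poisson_pmf l)) borel real) t = exp (of_real l * (iexp t - 1))"
proof -
  let ?f = "\<lambda>k. pmf (poisson_pmf l) k *\<^sub>R iexp t ^ k"
  have term_eq: "?f k = exp (- of_real l) * ((of_real l * iexp t) ^ k /\<^sub>R fact k)" for k
    using assms by (simp add: scaleR_conv_of_real power_mult_distrib exp_of_real exp_minus field_simps)
  have "summable (\<lambda>k. norm ((of_real l * iexp t) ^ k /\<^sub>R fact k))"
    by (rule summable_norm_exp)
  then have "integrable (count_space UNIV) ?f"
    unfolding integrable_count_space_nat_iff term_eq norm_mult by (rule summable_mult)
  then have "?f sums (CLINT k|count_space UNIV. ?f k)"
    by (rule sums_integral_count_space_nat)
  moreover have "?f sums (exp (- of_real l) * exp (of_real l * iexp t))"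
    unfolding term_eq by (intro sums_mult exp_converges)
  ultimately have eq: "(CLINT k|count_space UNIV. ?f k) = exp (- of_real l) * exp (of_real l * iexp t)"
    by (rule sums_unique2)
  have "char (distr (measure_pmf (poisson_pmf l)) borel real) t = (CLINT k|measure_pmf (poisson_pmf l). iexp t ^ k)"
    by (simp add: char_def integral_distr exp_of_nat_mult[symmetric] mult_ac)
  also have "\<dots> = (CLINT k|count_space UNIV. ?f k)"
    unfolding measure_pmf_eq_density by (rule integral_density) simp_all
  also have "\<dots> = exp (of_real l * (iexp t - 1))"
    unfolding eq by (simp add: exp_add[symmetric] algebra_simps)
  finally show ?thesis .
qed

lemma real_distribution_distr_pmf:
  "real_distribution (distr (measure_pmf p) borel f)"
  by (rule prob_space.real_distribution_distr[OF prob_space_measure_pmf]) simp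

theorem theorem6:
  "weak_conv_m
     (\<lambda>n. distr (measure_pmf (random_deck n)) borel (\<lambda>d. real (lucky_moves d)))
     (distr (measure_pmf (poisson_pmf (ln 2))) borel real)"
proof (rule levy_continuity)
  fix t
  have "char (distr (measure_pmf (poisson_pmf (ln 2))) borel real) t = exp (of_real (ln 2) * (iexp t - 1))"
    by (rule char_poisson) simp
  then show "(\<lambda>n. char (distr (measure_pmf (random_deck n)) borel (\<lambda>d. real (lucky_moves d))) t)
      \<longlonglongrightarrow> char (distr (measure_pmf (poisson_pmf (ln 2))) borel real) t"
    unfolding char_lucky_moves using generating_function_limit[of "iexp t"] by simp
qed (rule real_distribution_distr_pmf)+

end
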